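(* Let $y\in L^2(0,1)$ and let $(\lambda_k)_{k\ge0}$ be a nondecreasing sequence of positive numbers. For one-dimensional TV-denoising on $(0,1)$, the MHDM iterates coincide with the Tikhonov (TV-denoising) minimizers: $x_k=x_{\lambda_k}$ for all $k\in\mathbb N_0$.
   Context: $|u|_{TV}=\sup\{\int_0^1u\,\varphi'\,dt:\varphi\in C_c^\infty(0,1),\ \|\varphi\|_\infty\le1\}$ is the total variation seminorm on $L^2(0,1)$ (value $+\infty$ allowed). $x_\lambda$ is the unique minimizer in $L^2(0,1)$ of $x\mapsto\frac{\lambda}{2}\|x-y\|_{L^2}^2+|x|_{TV}$. MHDM: $x_0=x_{\lambda_0}$ and, for $k\ge1$, $x_k=\arg\min_{x\in L^2(0,1)}\frac{\lambda_k}{2}\|x-y\|_{L^2}^2+|x-x_{k-1}|_{TV}$ (unique). *)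

theory Defs
  imports "HOL-Analysis.Analysis"
begin

text \<open>Elements of L^2(0,1), represented by real functions (identified up to a.e. equality
  implicitly: all notions below are invariant under a.e. modification).\<close>
definition L2_01 :: "(real \<Rightarrow> real) set" where
  "L2_01 = {u. set_borel_measurable lborel {0<..<1} u \<and>
               set_integrable lborel {0<..<1} (\<lambda>t. (u t)\<^sup>2)}"

definition L2_dist_sq :: "(real \<Rightarrow> real) \<Rightarrow> (real \<Rightarrow> real) \<Rightarrow> real" where
  "L2_dist_sq u v = (LINT t:{0<..<1}|lborel. (u t - v t)\<^sup>2)"

definition smooth_fun :: "(real \<Rightarrow> real) \<Rightarrow> bool" where
  "smooth_fun \<phi> \<longleftrightarrow> (\<forall>n t. ((deriv ^^ n) \<phi>) differentiable (at t))"

definition Cc_inf_01 :: "(real \<Rightarrow> real) set" where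
  "Cc_inf_01 = {\<phi>. smooth_fun \<phi> \<and> compact (closure {t. \<phi> t \<noteq> 0}) \<and>
                    closure {t. \<phi> t \<noteq> 0} \<subseteq> {0<..<1}}"

definition TV :: "(real \<Rightarrow> real) \<Rightarrow> ereal" where
  "TV u = (SUP \<phi> \<in> {\<phi> \<in> Cc_inf_01. \<forall>t. \<bar>\<phi> t\<bar> \<le> 1}.
             ereal (LINT t:{0<..<1}|lborel. u t * deriv \<phi> t))"

definition tik_functional :: "real \<Rightarrow> (real \<Rightarrow> real) \<Rightarrow> (real \<Rightarrow> real) \<Rightarrow> ereal" where
  "tik_functional lam y x = ereal (lam / 2 * L2_dist_sq x y) + TV x"

definition is_tik_minimizer :: "real \<Rightarrow> (real \<Rightarrow> real) \<Rightarrow> (real \<Rightarrow> real) \<Rightarrow> bool" where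
  "is_tik_minimizer lam y x \<longleftrightarrow> x \<in> L2_01 \<and>
     (\<forall>z \<in> L2_01. tik_functional lam y x \<le> tik_functional lam y z)"

definition mhdm_functional ::
  "real \<Rightarrow> (real \<Rightarrow> real) \<Rightarrow> (real \<Rightarrow> real) \<Rightarrow> (real \<Rightarrow> real) \<Rightarrow> ereal" where
  "mhdm_functional lam y xprev x = ereal (lam / 2 * L2_dist_sq x y) + TV (\<lambda>t. x t - xprev t)"

definition is_mhdm_step :: "real \<Rightarrow> (real \<Rightarrow> real) \<Rightarrow> (real \<Rightarrow> real) \<Rightarrow> (real \<Rightarrow> real) \<Rightarrow> bool" where
  "is_mhdm_step lam y xprev x \<longleftrightarrow> x \<in> L2_01 \<and>
     (\<forall>z \<in> L2_01. mhdm_functional lam y xprev x \<le> mhdm_functional lam y xprev z)"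

end

theory Submission
  imports Defs "HOL-Computational_Algebra.Polynomial"
begin

text \<open>
  The subdifferential of the total variation at 0 consists of the \<open>r \<in> L\<^sup>2(0,1)\<close> whose primitive
  \<open>R(t) = \<integral>\<^sub>0\<^sup>t r\<close> satisfies \<open>\<bar>R\<bar> \<le> 1\<close> and \<open>R(1) = 0\<close>, and \<open>x\<close> is the TV-denoising minimizer for
  \<open>y\<close> iff \<open>q = \<lambda>(y - x)\<close> lies in this set and \<open>\<langle>q, x\<rangle> = TV x\<close>. Let \<open>a\<close> be the minimizer for
  \<open>\<mu> \<le> \<lambda>\<close>, \<open>p = \<mu>(y - a)\<close>, \<open>s = \<lambda>/\<mu>\<close>, and let \<open>x\<close> be the MHDM step from \<open>a\<close>, so that \<open>q\<close> is the
  projection of \<open>s p\<close> onto the dual set. A comparison argument for the primitives \<open>V\<close> of \<open>q\<close> and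
  \<open>W\<close> of \<open>p\<close> gives \<open>s W - (s - 1) \<le> V \<le> s W + (s - 1)\<close>: in particular \<open>V = W\<close> wherever \<open>W = \<plusminus>1\<close>,
  which is where \<open>a\<close> may vary. Quantitatively, \<open>p + (p - q)/s\<close> still lies in the dual set, whence
  \<open>\<langle>q, a\<rangle> = TV a\<close>. Together with \<open>\<langle>q, x - a\<rangle> = TV (x - a)\<close> this yields \<open>\<langle>q, x\<rangle> = TV x\<close>.

  That every such \<open>r\<close> satisfies \<open>\<langle>r, z\<rangle> \<le> TV z\<close> is shown by approximating \<open>r\<close> in \<open>L\<^sup>2\<close> by
  derivatives of polynomials \<open>G\<close> with \<open>G(0) = G(1) = 0\<close> and using the test functions
  \<open>G exp(-e/(G\<^sup>2 - e))\<close>, extended by 0 from \<open>{G\<^sup>2 > e}\<close>, as \<open>e \<rightarrow> 0\<close>.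
\<close>

subsection \<open>The inner product of \<open>L\<^sup>2(0,1)\<close>\<close>

text \<open>Integrating against a restricted measure turns the set integrals of the problem into
  plain integrals over a finite measure space, so linearity and dominated convergence apply without
  indicator factors.\<close>

definition M01 :: "real measure" where
  "M01 = restrict_space lborel {0<..<1}"

definition ip :: "(real \<Rightarrow> real) \<Rightarrow> (real \<Rightarrow> real) \<Rightarrow> real" where
  "ip u v = (\<integral>t. u t * v t \<partial>M01)"

lemma space_M01 [simp]: "space M01 = {0<..<1}"
  by (simp add: M01_def space_restrict_space)

lemma finite_measure_M01: "finite_measure M01"
  by (rule finite_measureI) (simp add: M01_def space_restrict_space emeasure_restrict_space)

lemma borel_measurable_M01I: "f \<in> borel_measurable borel \<Longrightarrow> f \<in> borel_measurable M01"
  unfolding M01_def by (rule measurable_restrict_space1) simp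

lemma AE_M01_iff: "(AE t in M01. P t) \<longleftrightarrow> (AE t in lborel. t \<in> {0<..<1} \<longrightarrow> P t)"
  unfolding M01_def by (rule AE_restrict_space_iff) simp

lemma AE_M01_notin_finite:
  assumes "finite S"
  shows "AE t in M01. t \<notin> S"
proof -
  have "AE t in lborel. t \<notin> S"
    using assms by (intro AE_not_in) (simp add: finite_imp_null_set_lborel)
  then show ?thesis
    unfolding AE_M01_iff by eventually_elim simp
qed

lemma L2_01_iff:
  "u \<in> L2_01 \<longleftrightarrow> u \<in> borel_measurable M01 \<and> integrable M01 (\<lambda>t. (u t)\<^sup>2)"
  unfolding L2_01_def M01_def set_borel_measurable_def set_integrable_def
  by (simp add: borel_measurable_restrict_space_iff integrable_restrict_space)

lemma L2_01_measurable [measurable_dest]: "u \<in> L2_01 \<Longrightarrow> u \<in> borel_measurable M01"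
  by (simp add: L2_01_iff)

lemma L2_dist_sq_eq_ip: "L2_dist_sq u v = ip (\<lambda>t. u t - v t) (\<lambda>t. u t - v t)"
  unfolding L2_dist_sq_def ip_def M01_def set_lebesgue_integral_def
  by (simp add: integral_restrict_space power2_eq_square)

lemma TV_eq_ip:
  "TV u = (SUP \<phi> \<in> {\<phi> \<in> Cc_inf_01. \<forall>t. \<bar>\<phi> t\<bar> \<le> 1}. ereal (ip u (deriv \<phi>)))"
  unfolding TV_def ip_def M01_def set_lebesgue_integral_def
  by (simp add: integral_restrict_space)

lemma integrable_mult_L2_01:
  assumes "u \<in> L2_01" "v \<in> L2_01"
  shows "integrable M01 (\<lambda>t. u t * v t)"
proof (rule Bochner_Integration.integrable_bound)
  show "integrable M01 (\<lambda>t. (u t)\<^sup>2 + (v t)\<^sup>2)"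
    using assms by (simp add: L2_01_iff)
  show "(\<lambda>t. u t * v t) \<in> borel_measurable M01"
    using assms by measurable
  have "norm (a * b) \<le> norm (a\<^sup>2 + b\<^sup>2)" for a b :: real
  proof -
    have "2 * \<bar>a * b\<bar> \<le> a\<^sup>2 + b\<^sup>2"
      using sum_squares_bound[of "\<bar>a\<bar>" "\<bar>b\<bar>"] by (simp add: abs_mult)
    then have "\<bar>a * b\<bar> \<le> a\<^sup>2 + b\<^sup>2"
      using abs_ge_zero[of "a * b"] by linarith
    then show ?thesis by simp
  qed
  then show "AE t in M01. norm (u t * v t) \<le> norm ((u t)\<^sup>2 + (v t)\<^sup>2)"
    by simp
qed

lemma L2_01_lincomb:
  assumes "u \<in> L2_01" "v \<in> L2_01"
  shows "(\<lambda>t. a * u t + b * v t) \<in> L2_01"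
proof -
  have "(\<lambda>t. (a * u t + b * v t)\<^sup>2) =
    (\<lambda>t. a\<^sup>2 * (u t)\<^sup>2 + (2 * a * b) * (u t * v t) + b\<^sup>2 * (v t)\<^sup>2)"
    by (simp add: power2_eq_square algebra_simps)
  moreover have "(\<lambda>t. a * u t + b * v t) \<in> borel_measurable M01"
    using assms by measurable
  moreover have "integrable M01 (\<lambda>t. (u t)\<^sup>2)" "integrable M01 (\<lambda>t. (v t)\<^sup>2)"
    using assms by (auto simp: L2_01_iff)
  ultimately show ?thesis
    unfolding L2_01_iff using integrable_mult_L2_01[OF assms] by simp
qed

lemma L2_01_diff: "u \<in> L2_01 \<Longrightarrow> v \<in> L2_01 \<Longrightarrow> (\<lambda>t. u t - v t) \<in> L2_01"
  using L2_01_lincomb[of u v 1 "-1"] by simp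

lemma L2_01_add: "u \<in> L2_01 \<Longrightarrow> v \<in> L2_01 \<Longrightarrow> (\<lambda>t. u t + v t) \<in> L2_01"
  using L2_01_lincomb[of u v 1 1] by simp

lemma L2_01_cmult: "u \<in> L2_01 \<Longrightarrow> (\<lambda>t. c * u t) \<in> L2_01"
  using L2_01_lincomb[of u u c 0] by simp

lemma L2_01_bounded:
  assumes "u \<in> borel_measurable M01" and "\<And>t. t \<in> {0<..<1} \<Longrightarrow> \<bar>u t\<bar> \<le> B"
  shows "u \<in> L2_01"
proof -
  interpret finite_measure M01 by (rule finite_measure_M01)
  have "integrable M01 (\<lambda>t. (u t)\<^sup>2)"
  proof (rule integrable_const_bound)
    show "AE t in M01. norm ((u t)\<^sup>2) \<le> B\<^sup>2"
      using assms(2) by (intro AE_I2) (force simp: abs_le_square_iff[symmetric])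
  qed (use assms in simp)
  with assms show ?thesis by (simp add: L2_01_iff)
qed

lemma L2_01_continuous:
  assumes "continuous_on UNIV f"
  shows "f \<in> L2_01"
proof -
  have "continuous_on {0..1} f"
    using assms continuous_on_subset by blast
  then have "bounded (f ` {0..1})"
    by (intro compact_imp_bounded compact_continuous_image) auto
  then obtain B where "\<And>t. t \<in> {0..1} \<Longrightarrow> \<bar>f t\<bar> \<le> B"
    unfolding bounded_iff by (metis imageI real_norm_def)
  then show ?thesis
    using assms by (intro L2_01_bounded[of _ B] borel_measurable_M01I borel_measurable_continuous_onI) auto
qed

lemma L2_01_restrict:
  assumes "u \<in> L2_01" "A \<in> sets borel"
  shows "(\<lambda>t. u t * indicator A t) \<in> L2_01"
proof -
  have m: "(indicator A :: real \<Rightarrow> real) \<in> borel_measurable M01"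
    using assms by (intro borel_measurable_M01I) simp
  have um: "(\<lambda>t. u t * indicator A t) \<in> borel_measurable M01"
    using assms(1) m by measurable
  have "integrable M01 (\<lambda>t. (u t * indicator A t)\<^sup>2)"
    by (rule Bochner_Integration.integrable_bound[of _ "\<lambda>t. (u t)\<^sup>2"])
       (use assms um in \<open>auto simp: L2_01_iff indicator_def\<close>)
  with um show ?thesis by (simp add: L2_01_iff)
qed

lemma L2_01_indicator: "A \<in> sets borel \<Longrightarrow> indicator A \<in> L2_01"
  using L2_01_restrict[OF L2_01_continuous[of "\<lambda>_. 1"]] by simp

lemma ip_commute: "ip u v = ip v u"
  by (simp add: ip_def mult.commute)

lemma ip_lincomb_left:
  assumes "u \<in> L2_01" "v \<in> L2_01" "w \<in> L2_01"
  shows "ip (\<lambda>t. a * u t + b * v t) w = a * ip u w + b * ip v w"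
proof -
  have "(\<lambda>t. (a * u t + b * v t) * w t) = (\<lambda>t. a * (u t * w t) + b * (v t * w t))"
    by (simp add: algebra_simps)
  then show ?thesis
    using assms by (simp add: ip_def integrable_mult_L2_01)
qed

lemma ip_lincomb_right:
  assumes "u \<in> L2_01" "v \<in> L2_01" "w \<in> L2_01"
  shows "ip w (\<lambda>t. a * u t + b * v t) = a * ip w u + b * ip w v"
  using ip_lincomb_left[OF assms] by (simp add: ip_commute)

lemma ip_add_left:
  "u \<in> L2_01 \<Longrightarrow> v \<in> L2_01 \<Longrightarrow> w \<in> L2_01 \<Longrightarrow> ip (\<lambda>t. u t + v t) w = ip u w + ip v w"
  using ip_lincomb_left[of u v w 1 1] by simp

lemma ip_diff_left:
  "u \<in> L2_01 \<Longrightarrow> v \<in> L2_01 \<Longrightarrow> w \<in> L2_01 \<Longrightarrow> ip (\<lambda>t. u t - v t) w = ip u w - ip v w"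
  using ip_lincomb_left[of u v w 1 "-1"] by simp

lemma ip_diff_right:
  "u \<in> L2_01 \<Longrightarrow> v \<in> L2_01 \<Longrightarrow> w \<in> L2_01 \<Longrightarrow> ip w (\<lambda>t. u t - v t) = ip w u - ip w v"
  using ip_lincomb_right[of u v w 1 "-1"] by simp

lemma ip_cmult_left: "ip (\<lambda>t. c * u t) w = c * ip u w"
  by (simp add: ip_def mult.assoc)

lemma ip_cmult_right: "ip w (\<lambda>t. c * u t) = c * ip w u"
  by (simp add: ip_def mult.left_commute)

lemma ip_self_nonneg: "0 \<le> ip u u"
  unfolding ip_def by (rule integral_nonneg_AE) simp

lemma ip_self_lincomb:
  assumes "u \<in> L2_01" "v \<in> L2_01"
  shows "ip (\<lambda>t. a * u t + b * v t) (\<lambda>t. a * u t + b * v t) =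
    a\<^sup>2 * ip u u + 2 * a * b * ip u v + b\<^sup>2 * ip v v"
  using assms ip_commute[of v u]
  by (simp add: ip_lincomb_left ip_lincomb_right L2_01_lincomb power2_eq_square algebra_simps)

lemma ip_Cauchy_Schwarz:
  assumes u: "u \<in> L2_01" and v: "v \<in> L2_01"
  shows "\<bar>ip u v\<bar> \<le> sqrt (ip u u) * sqrt (ip v v)"
proof -
  \<comment> \<open>This combination is orthogonal to \<open>v\<close>; scaling by
    \<open>ip v v\<close> avoids dividing by a quantity that may vanish.\<close>
  have "0 \<le> ip (\<lambda>t. ip v v * u t + (- ip u v) * v t) (\<lambda>t. ip v v * u t + (- ip u v) * v t)"
    by (rule ip_self_nonneg)
  then have 1: "0 \<le> ip v v * (ip u u * ip v v - (ip u v)\<^sup>2)"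
    by (subst (asm) ip_self_lincomb[OF u v]) (simp add: power2_eq_square algebra_simps)
  have "(ip u v)\<^sup>2 \<le> ip u u * ip v v"
  proof (cases "ip v v = 0")
    case False
    then show ?thesis using 1 ip_self_nonneg[of v] by (simp add: zero_le_mult_iff)
  next
    case True
    have "0 \<le> ip (\<lambda>t. 1 * u t + c * v t) (\<lambda>t. 1 * u t + c * v t)" for c
      by (rule ip_self_nonneg)
    then have *: "0 \<le> ip u u + 2 * c * ip u v" for c
      unfolding ip_self_lincomb[OF u v] using True by simp
    have "ip u v = 0"
    proof (rule ccontr)
      assume "ip u v \<noteq> 0"
      \<comment> \<open>This value of \<open>c\<close> makes the affine expression in
        \<open>*\<close> equal to -1.\<close>
      then show False using *[of "- (ip u u + 1) / (2 * ip u v)"] by (simp add: field_simps)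
    qed
    then show ?thesis using True by simp
  qed
  then show ?thesis
    using real_sqrt_le_mono by (fastforce simp: real_sqrt_mult)
qed

text \<open>On (0,1), pairing with \<open>indicator {..t}\<close> is integration from 0 to
  \<open>t\<close>; primitives take this form throughout. It can differ from the integrand on
  \<open>{0..t}\<close> only at the points 0 and 1.\<close>

lemma ip_indicator_atMost_FTC:
  assumes t: "0 \<le> t" "t \<le> 1"
    and F: "\<And>s. (F has_real_derivative f s) (at s)" and f: "continuous_on UNIV f"
  shows "ip f (indicator {..t}) = F t - F 0"
proof -
  have "ip f (indicator {..t}) = (\<integral>s. indicator {0<..<1} s * (f s * indicator {..t} s) \<partial>lborel)"
    unfolding ip_def M01_def by (simp add: integral_restrict_space)
  also have "\<dots> = (\<integral>s. f s * indicator {0..t} s \<partial>lborel)"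
  proof (rule integral_cong_AE)
    have "AE s in lborel. s \<notin> {0, 1 :: real}"
      by (intro AE_not_in finite_imp_null_set_lborel) simp
    then show "AE s in lborel. indicator {0<..<1} s * (f s * indicator {..t} s) = f s * indicator {0..t} s"
      by eventually_elim (use t in \<open>auto simp: indicator_def\<close>)
    show "(\<lambda>s. indicator {0<..<1} s * (f s * indicator {..t} s)) \<in> borel_measurable lborel"
      "(\<lambda>s. f s * indicator {0..t} s) \<in> borel_measurable lborel"
      using borel_measurable_continuous_onI[OF f] by measurable
  qed
  also have "\<dots> = F t - F 0"
    using t F f by (intro integral_FTC_Icc_real) (auto simp: continuous_on_eq_continuous_at)
  finally show ?thesis .
qed

subsection \<open>Total variation\<close>

lemma Cc_inf_01_DERIV: "\<phi> \<in> Cc_inf_01 \<Longrightarrow> (\<phi> has_real_derivative deriv \<phi> t) (at t)"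
  unfolding Cc_inf_01_def smooth_fun_def DERIV_deriv_iff_real_differentiable
  by (metis (no_types, lifting) funpow_0 mem_Collect_eq)

lemma Cc_inf_01_continuous_deriv:
  assumes "\<phi> \<in> Cc_inf_01"
  shows "continuous_on UNIV (deriv \<phi>)"
proof -
  have "deriv \<phi> differentiable at t" for t
    using assms unfolding Cc_inf_01_def smooth_fun_def by (auto dest!: spec[of _ "1::nat"])
  then show ?thesis
    by (simp add: continuous_on_eq_continuous_at differentiable_imp_continuous_within)
qed

lemma Cc_inf_01_deriv_L2: "\<phi> \<in> Cc_inf_01 \<Longrightarrow> deriv \<phi> \<in> L2_01"
  by (intro L2_01_continuous Cc_inf_01_continuous_deriv)

lemma Cc_inf_01_endpoints:
  assumes "\<phi> \<in> Cc_inf_01"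
  shows "\<phi> 0 = 0" "\<phi> 1 = 0"
  using assms closure_subset[of "{t. \<phi> t \<noteq> 0}"] by (auto simp: Cc_inf_01_def)

lemma zero_in_Cc_inf_01: "(\<lambda>_. 0) \<in> Cc_inf_01"
proof -
  have "(deriv ^^ n) (\<lambda>_. 0) = (\<lambda>_. 0 :: real)" for n
    by (induction n) auto
  then show ?thesis by (simp add: Cc_inf_01_def smooth_fun_def)
qed

lemma TV_upper:
  "\<phi> \<in> Cc_inf_01 \<Longrightarrow> (\<And>t. \<bar>\<phi> t\<bar> \<le> 1) \<Longrightarrow> ereal (ip u (deriv \<phi>)) \<le> TV u"
  unfolding TV_eq_ip by (rule SUP_upper) auto

lemma TV_least:
  "(\<And>\<phi>. \<phi> \<in> Cc_inf_01 \<Longrightarrow> (\<And>t. \<bar>\<phi> t\<bar> \<le> 1) \<Longrightarrow> ereal (ip u (deriv \<phi>)) \<le> C) \<Longrightarrow> TV u \<le> C"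
  unfolding TV_eq_ip by (rule SUP_least) auto

lemma TV_nonneg: "0 \<le> TV u"
  using TV_upper[OF zero_in_Cc_inf_01, of u] by (simp add: ip_def zero_ereal_def)

lemma TV_triangle:
  assumes "u \<in> L2_01" "v \<in> L2_01"
  shows "TV (\<lambda>t. u t + v t) \<le> TV u + TV v"
proof (rule TV_least)
  fix \<phi> assume *: "\<phi> \<in> Cc_inf_01" "\<And>t. \<bar>\<phi> t\<bar> \<le> 1"
  have "ereal (ip (\<lambda>t. u t + v t) (deriv \<phi>)) = ereal (ip u (deriv \<phi>)) + ereal (ip v (deriv \<phi>))"
    using assms * by (simp add: ip_add_left Cc_inf_01_deriv_L2)
  also have "\<dots> \<le> TV u + TV v"
    by (intro add_mono TV_upper *)
  finally show "ereal (ip (\<lambda>t. u t + v t) (deriv \<phi>)) \<le> TV u + TV v" .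
qed

lemma TV_cmult_le:
  assumes "0 \<le> c"
  shows "TV (\<lambda>t. c * u t) \<le> ereal c * TV u"
proof (rule TV_least)
  fix \<phi> assume *: "\<phi> \<in> Cc_inf_01" "\<And>t. \<bar>\<phi> t\<bar> \<le> 1"
  have "ereal (ip (\<lambda>t. c * u t) (deriv \<phi>)) = ereal c * ereal (ip u (deriv \<phi>))"
    by (simp add: ip_cmult_left)
  also have "\<dots> \<le> ereal c * TV u"
    using assms by (intro ereal_mult_left_mono TV_upper *) auto
  finally show "ereal (ip (\<lambda>t. c * u t) (deriv \<phi>)) \<le> ereal c * TV u" .
qed

lemma ip_indicator_deriv_Cc_inf_01:
  assumes "\<phi> \<in> Cc_inf_01" "0 \<le> t" "t \<le> 1"
  shows "ip (\<lambda>s. c * indicator {..t} s) (deriv \<phi>) = c * \<phi> t"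
proof -
  have "ip (deriv \<phi>) (indicator {..t}) = \<phi> t - \<phi> 0"
    using assms by (intro ip_indicator_atMost_FTC Cc_inf_01_DERIV Cc_inf_01_continuous_deriv)
  then show ?thesis
    using Cc_inf_01_endpoints[OF assms(1)] by (simp add: ip_cmult_left ip_commute)
qed

text \<open>A single jump of height \<open>c\<close> pairs with \<open>deriv \<phi>\<close> to
  \<open>c * \<phi> t\<close>. Such step functions later serve as the tests that recover the bound
  on a primitive.\<close>

lemma TV_indicator_atMost:
  assumes "0 \<le> t" "t \<le> 1"
  shows "TV (\<lambda>s. c * indicator {..t} s) \<le> ereal \<bar>c\<bar>"
proof (rule TV_least)
  fix \<phi> assume *: "\<phi> \<in> Cc_inf_01" "\<And>t. \<bar>\<phi> t\<bar> \<le> 1"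
  have "c * \<phi> t \<le> \<bar>c * \<phi> t\<bar>" by simp
  also have "\<dots> \<le> \<bar>c\<bar>"
    using *(2)[of t] by (simp add: abs_mult mult_left_le)
  finally show "ereal (ip (\<lambda>s. c * indicator {..t} s) (deriv \<phi>)) \<le> ereal \<bar>c\<bar>"
    using assms * by (simp add: ip_indicator_deriv_Cc_inf_01)
qed

text \<open>A jump at 1 leaves a constant on (0,1). Testing with it forces the primitive to vanish
  at 1.\<close>

lemma TV_indicator_atMost_1: "TV (\<lambda>s. c * indicator {..1} s) \<le> 0"
  by (rule TV_least) (simp add: ip_indicator_deriv_Cc_inf_01 Cc_inf_01_endpoints)

subsection \<open>Smooth cutoffs of polynomials\<close>

lemma smooth_fun_coinduct:
  assumes "P \<phi>" and step: "\<And>f. P f \<Longrightarrow> (\<forall>t. f differentiable at t) \<and> P (deriv f)"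
  shows "smooth_fun \<phi>"
proof -
  have "P ((deriv ^^ n) \<phi>)" for n
    by (induction n) (use assms in auto)
  then show ?thesis
    using step by (auto simp: smooth_fun_def)
qed

text \<open>The parameters \<open>k\<close> and \<open>A\<close> make the family closed under
  differentiation, starting from \<open>k = 0\<close>; the exponential flattens the function at the
  edge of the region where \<open>H\<close> is positive.\<close>

definition cutoff :: "real \<Rightarrow> real poly \<Rightarrow> nat \<Rightarrow> real poly \<Rightarrow> real \<Rightarrow> real" where
  "cutoff e H k A t =
    (if 0 < t \<and> t < 1 \<and> 0 < poly H t then poly A t * exp (- e / poly H t) / poly H t ^ k else 0)"

text \<open>With \<open>w = e / h\<close>, one term of the exponential series gives
  \<open>w ^ (k + 2) / fact (k + 2) \<le> exp w\<close>. The two powers beyond \<open>k\<close>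
  leave the factor \<open>h\<^sup>2\<close>, which later gives derivative 0 at the edge.\<close>

lemma exp_minus_inverse_le:
  fixes e h :: real
  assumes "0 < e" "0 < h"
  shows "exp (- e / h) / h ^ k \<le> fact (k + 2) / e ^ (k + 2) * h\<^sup>2"
proof -
  define w where "w = e / h"
  have w: "0 < w" using assms by (simp add: w_def)
  have "(\<Sum>m\<in>{k + 2}. w ^ m / fact m) \<le> (\<Sum>m<k+3. w ^ m / fact m)"
    using w by (intro sum_mono2) auto
  also have "\<dots> \<le> exp w"
    using Maclaurin_exp_le[of w "k+3"] w by auto
  finally have "w ^ (k + 2) / fact (k + 2) \<le> exp w" by simp
  then have "exp (- w) * w ^ (k + 2) \<le> fact (k + 2)"
    by (simp add: exp_minus divide_le_eq mult.commute inverse_eq_divide del: fact_Suc power_Suc add_2_eq_Suc')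
  then show ?thesis
    using assms
    by (simp add: w_def power_divide power_add divide_le_eq le_divide_eq power2_eq_square mult_ac
        del: fact_Suc power_Suc add_2_eq_Suc')
qed

lemma has_real_derivative_zeroI:
  assumes "\<And>s. \<bar>f s\<bar> \<le> C * (s - t)\<^sup>2" 
  shows "(f has_real_derivative 0) (at t)"
proof -
  have f0: "f t = 0" using assms[of t] by simp
  have "((\<lambda>s. (f s - f t) / (s - t)) \<longlongrightarrow> 0) (at t)"
  proof (rule Lim_null_comparison)
    show "((\<lambda>s. C * \<bar>s - t\<bar>) \<longlongrightarrow> 0) (at t)"
      by (rule tendsto_eq_intros refl | simp)+
    have "norm ((f s - f t) / (s - t)) \<le> C * \<bar>s - t\<bar>" if "s \<noteq> t" for s
    proof -
      have "\<bar>f s\<bar> / \<bar>s - t\<bar> \<le> C * (s - t)\<^sup>2 / \<bar>s - t\<bar>"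
        by (intro divide_right_mono assms) simp
      also have "\<dots> = C * \<bar>s - t\<bar>"
        using that by (simp add: power2_eq_square field_simps abs_mult_self_eq flip: abs_mult)
      finally show ?thesis using f0 by simp
    qed
    then show "\<forall>\<^sub>F s in at t. norm ((f s - f t) / (s - t)) \<le> C * \<bar>s - t\<bar>"
      by (auto simp: eventually_at intro: exI[of _ 1])
  qed
  then show ?thesis by (simp add: has_field_derivative_iff)
qed

lemma poly_bounded_01: "\<exists>B>0. \<forall>t\<in>{0..1}. \<bar>poly p t\<bar> \<le> (B::real)"
proof -
  have "bounded (poly p ` {0..1})"
    by (intro compact_imp_bounded compact_continuous_image continuous_intros) auto
  then show ?thesis
    unfolding bounded_pos by (metis imageI real_norm_def)
qed

text \<open>The exponential absorbs the denominator and leaves a multiple of the square of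
  \<open>H\<close>, while \<open>H\<close> grows at most linearly away from a point where it is not
  positive.\<close>

lemma cutoff_quadratic_bound:
  assumes e: "0 < e" and H: "poly H 0 < 0" "poly H 1 < 0"
    and t: "\<not> (0 < t \<and> t < 1 \<and> 0 < poly H t)"
  shows "\<exists>C. \<forall>s. \<bar>cutoff e H k A s\<bar> \<le> C * (s - t)\<^sup>2"
proof -
  obtain B where B: "B > 0" "\<And>s. s \<in> {0..1} \<Longrightarrow> \<bar>poly A s\<bar> \<le> B"
    using poly_bounded_01 by blast
  obtain L where L: "L > 0" "\<And>s. s \<in> {0..1} \<Longrightarrow> \<bar>poly (pderiv H) s\<bar> \<le> L"
    using poly_bounded_01 by blast
  define D where "D = fact (k + 2) / e ^ (k + 2)"
  have D: "D > 0" using e by (simp add: D_def)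
  have "\<bar>cutoff e H k A s\<bar> \<le> B * D * L\<^sup>2 * (s - t)\<^sup>2" for s
  proof (cases "0 < s \<and> s < 1 \<and> 0 < poly H s")
    case False
    then show ?thesis using B D by (auto simp: cutoff_def)
  next
    case True
    \<comment> \<open>The projection of \<open>t\<close> onto [0,1]: it is no farther from
      \<open>s\<close> than \<open>t\<close> is, and \<open>H\<close> is nonpositive there, by the
      endpoint conditions if \<open>t\<close> lies outside.\<close>
    define c where "c = max 0 (min 1 t)"
    have c: "c \<in> {0..1}" "poly H c \<le> 0" "\<bar>s - c\<bar> \<le> \<bar>s - t\<bar>"
      using t H True by (auto simp: c_def min_def max_def not_less)
    have "norm (poly H s - poly H c) \<le> L * norm (s - c)"
    proof (rule field_differentiable_bound[of "{0..1}" _ "poly (pderiv H)"])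
      show "norm (poly (pderiv H) z) \<le> L" if "z \<in> {0..1}" for z
        using L that by simp
    qed (use c True in \<open>auto intro: DERIV_subset[OF poly_DERIV]\<close>)
    then have "poly H s \<le> L * \<bar>s - c\<bar>"
      using c by simp
    also have "\<dots> \<le> L * \<bar>s - t\<bar>"
      using c L by simp
    finally have "(poly H s)\<^sup>2 \<le> (L * \<bar>s - t\<bar>)\<^sup>2"
      using True by (intro power_mono) auto
    then have H2: "(poly H s)\<^sup>2 \<le> L\<^sup>2 * (s - t)\<^sup>2"
      by (simp add: power_mult_distrib)
    have "\<bar>cutoff e H k A s\<bar> = \<bar>poly A s\<bar> * (exp (- e / poly H s) / poly H s ^ k)"
      using True by (simp add: cutoff_def abs_mult)
    also have "\<dots> \<le> B * (D * (poly H s)\<^sup>2)"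
      unfolding D_def using B True e by (intro mult_mono exp_minus_inverse_le) auto
    also have "\<dots> \<le> B * (D * (L\<^sup>2 * (s - t)\<^sup>2))"
      using B D H2 by (intro mult_left_mono) auto
    finally show ?thesis by (simp add: mult.assoc)
  qed
  then show ?thesis by blast
qed

text \<open>Inside the region this is the product rule over the common denominator
  \<open>H ^ (k + 2)\<close>; outside, the quadratic bound gives derivative 0.\<close>

lemma cutoff_DERIV:
  assumes e: "0 < e" and H: "poly H 0 < 0" "poly H 1 < 0"
  shows "(cutoff e H k A has_real_derivative
    cutoff e H (k + 2) (pderiv A * H\<^sup>2 - smult (of_nat k) (A * H * pderiv H) + smult e (A * pderiv H)) t) (at t)"
proof (cases "0 < t \<and> t < 1 \<and> 0 < poly H t")
  case False
  then obtain C where "\<And>s. \<bar>cutoff e H k A s\<bar> \<le> C * (s - t)\<^sup>2"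
    using cutoff_quadratic_bound[OF e H] by blast
  then have "(cutoff e H k A has_real_derivative 0) (at t)"
    by (rule has_real_derivative_zeroI)
  moreover have "cutoff e H j A' t = 0" for j A'
    using False unfolding cutoff_def by (rule if_not_P)
  ultimately show ?thesis by simp
next
  case True
  define U where "U = {t. 0 < t \<and> t < 1 \<and> 0 < poly H t}"
  have "open U"
    unfolding U_def by (intro open_Collect_conj open_Collect_less continuous_intros)
  have h: "poly H t > 0" using True by simp
  let ?h = "poly H t" and ?h' = "poly (pderiv H) t" and ?E = "exp (- e / poly H t)"
  have inv: "((\<lambda>s. inverse (poly H s) ^ k) has_real_derivative - (of_nat k * ?h') / ?h ^ (k + 1)) (at t)"
  proof (rule DERIV_cong)
    show "((\<lambda>s. inverse (poly H s) ^ k) has_real_derivative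
        of_nat k * (inverse ?h ^ (k - 1) * (- (inverse ?h * ?h' * inverse ?h)))) (at t)"
      using h by (auto intro!: derivative_eq_intros)
    \<comment> \<open>The case split on \<open>k\<close> handles the truncated exponent
      \<open>k - 1\<close>; at \<open>k = 0\<close> the factor \<open>of_nat k\<close> makes both
      sides 0.\<close>
    show "of_nat k * (inverse ?h ^ (k - 1) * (- (inverse ?h * ?h' * inverse ?h))) =
        - (of_nat k * ?h') / ?h ^ (k + 1)"
      using h by (cases k) (simp_all add: field_simps)
  qed
  have exp: "((\<lambda>s. exp (- e / poly H s)) has_real_derivative ?E * (e * ?h' / ?h\<^sup>2)) (at t)"
    using h by (auto intro!: derivative_eq_intros simp: power2_eq_square)
  have "((\<lambda>s. poly A s * exp (- e / poly H s) * inverse (poly H s) ^ k) has_real_derivative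
    cutoff e H (k + 2) (pderiv A * H\<^sup>2 - smult (of_nat k) (A * H * pderiv H) + smult e (A * pderiv H)) t) (at t)"
  proof (rule DERIV_cong[OF DERIV_mult[OF DERIV_mult[OF poly_DERIV exp] inv]])
    have "(poly (pderiv A) t * ?E + ?E * (e * ?h' / ?h\<^sup>2) * poly A t) * inverse ?h ^ k +
        - (of_nat k * ?h') / ?h ^ (k + 1) * (poly A t * ?E) =
      (poly (pderiv A) t * ?h\<^sup>2 - of_nat k * (poly A t * ?h * ?h') + e * (poly A t * ?h')) * ?E / ?h ^ (k + 2)"
      using h by (simp add: power_add power2_eq_square divide_simps power_inverse) (simp add: algebra_simps)
    then show "(poly (pderiv A) t * ?E + ?E * (e * ?h' / ?h\<^sup>2) * poly A t) * inverse ?h ^ k +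
        - (of_nat k * ?h') / ?h ^ (k + 1) * (poly A t * ?E) =
      cutoff e H (k + 2) (pderiv A * H\<^sup>2 - smult (of_nat k) (A * H * pderiv H) + smult e (A * pderiv H)) t"
      unfolding cutoff_def if_P[OF True] by (simp add: mult.assoc)
  qed
  then have "((\<lambda>s. poly A s * exp (- e / poly H s) / poly H s ^ k) has_real_derivative
    cutoff e H (k + 2) (pderiv A * H\<^sup>2 - smult (of_nat k) (A * H * pderiv H) + smult e (A * pderiv H)) t) (at t)"
    by (simp add: power_inverse divide_inverse)
  then show ?thesis
    by (rule has_field_derivative_transform_within_open[OF _ \<open>open U\<close>])
       (use True in \<open>auto simp: U_def cutoff_def\<close>)
qed

lemma cutoff_smooth:
  assumes "0 < e" "poly H 0 < 0" "poly H 1 < 0"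
  shows "smooth_fun (cutoff e H k A)"
proof (rule smooth_fun_coinduct[where P = "\<lambda>f. \<exists>k A. f = cutoff e H k A"])
  fix f assume "\<exists>k A. f = cutoff e H k A"
  then obtain k A where f: "f = cutoff e H k A" by blast
  note D = cutoff_DERIV[OF assms, of k A]
  have "deriv f = cutoff e H (k + 2)
      (pderiv A * H\<^sup>2 - smult (of_nat k) (A * H * pderiv H) + smult e (A * pderiv H))"
    unfolding f by (rule ext) (rule DERIV_imp_deriv[OF D])
  then show "(\<forall>t. f differentiable at t) \<and> (\<exists>k A. deriv f = cutoff e H k A)"
    using D unfolding f real_differentiable_def by blast
qed blast

text \<open>The support lies in the compact set of points of [0,1] where \<open>H\<close> is
  nonnegative, which misses both endpoints since \<open>H\<close> is negative there.\<close>

lemma cutoff_Cc_inf_01: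
  assumes "0 < e" "poly H 0 < 0" "poly H 1 < 0"
  shows "cutoff e H k A \<in> Cc_inf_01"
proof -
  let ?K = "{t \<in> {0..1}. 0 \<le> poly H t}"
  have "{t. 0 \<le> poly H t} \<inter> {0..1} = ?K" by auto
  moreover have "closed {t. 0 \<le> poly H t}"
    by (intro closed_Collect_le continuous_intros)
  ultimately have "compact ?K"
    by (metis closed_Int_compact compact_Icc)
  moreover have sub: "closure {t. cutoff e H k A t \<noteq> 0} \<subseteq> ?K"
    using \<open>compact ?K\<close> by (intro closure_minimal compact_imp_closed) (auto simp: cutoff_def split: if_splits)
  moreover have "?K \<subseteq> {0<..<1}"
    using assms by (auto simp: less_eq_real_def)
  moreover have "compact (closure {t. cutoff e H k A t \<noteq> 0})"
    unfolding compact_eq_bounded_closed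
    using bounded_subset[OF compact_imp_bounded[OF \<open>compact ?K\<close>] sub] by simp
  ultimately show ?thesis
    using cutoff_smooth[OF assms] by (auto simp: Cc_inf_01_def)
qed

subsection \<open>Density of polynomials\<close>

text \<open>The parallelogram law with the square of the difference dropped; a triangle inequality
  free of square roots.\<close>

lemma ip_self_add_le:
  assumes "u \<in> L2_01" "v \<in> L2_01"
  shows "ip (\<lambda>t. u t + v t) (\<lambda>t. u t + v t) \<le> 2 * ip u u + 2 * ip v v"
proof -
  have "0 \<le> ip (\<lambda>t. 1 * u t + (-1) * v t) (\<lambda>t. 1 * u t + (-1) * v t)"
    by (rule ip_self_nonneg)
  then show ?thesis
    using ip_self_lincomb[OF assms, of 1 "-1"] ip_self_lincomb[OF assms, of 1 1] by simp
qed

lemma ip_self_le_bound: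
  assumes "u \<in> L2_01" "\<And>t. t \<in> {0<..<1} \<Longrightarrow> \<bar>u t\<bar> \<le> B"
  shows "ip u u \<le> B\<^sup>2"
proof -
  interpret finite_measure M01 by (rule finite_measure_M01)
  have "ip u u \<le> (\<integral>t. B\<^sup>2 \<partial>M01)"
    unfolding ip_def
  proof (rule integral_mono)
    fix t assume "t \<in> space M01"
    then have "\<bar>u t\<bar> \<le> B" using assms by simp
    then have "\<bar>u t\<bar>\<^sup>2 \<le> B\<^sup>2" by (intro power_mono) auto
    then show "u t * u t \<le> B\<^sup>2" by (simp add: power2_eq_square)
  qed (use assms integrable_mult_L2_01 in auto)
  also have "\<dots> = B\<^sup>2"
    by (simp add: M01_def measure_restrict_space space_restrict_space)
  finally show ?thesis .
qed

text \<open>A measurable function is an a.e. limit of continuous ones. Clamping these to [-B, B]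
  keeps both continuity and the limit, and supplies the constant \<open>4 * B\<^sup>2\<close> for
  dominated convergence.\<close>

lemma continuous_dense_L2_01_bounded:
  assumes u: "u \<in> borel_measurable M01" and B: "\<And>t. \<bar>u t\<bar> \<le> B" and e: "0 < e"
  shows "\<exists>h. continuous_on UNIV h \<and> ip (\<lambda>t. u t - h t) (\<lambda>t. u t - h t) < e"
proof -
  interpret finite_measure M01 by (rule finite_measure_M01)
  have "(\<lambda>t. indicator {0<..<1} t *\<^sub>R u t) \<in> borel_measurable lborel"
    using u unfolding M01_def by (simp add: borel_measurable_restrict_space_iff)
  then have "(\<lambda>t. indicator {0<..<1} t *\<^sub>R u t) \<in> borel_measurable lebesgue"
    by (rule measurable_completion)
  then have "(\<lambda>t. indicator {0<..<1} t *\<^sub>R u t) measurable_on UNIV"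
    by (rule lebesgue_measurable_imp_measurable_on_real) simp
  then obtain N g where N: "negligible N" and g: "\<And>n. continuous_on UNIV (g n)"
    and lim: "\<And>t. t \<notin> N \<Longrightarrow> (\<lambda>n. g n t) \<longlonglongrightarrow> indicator {0<..<1} t *\<^sub>R u t"
    unfolding measurable_on_def by (simp, blast)
  define h where "h n t = max (- B) (min B (g n t))" for n t
  have h: "continuous_on UNIV (h n)" for n
    unfolding h_def by (intro continuous_intros g)
  have "(\<lambda>n. \<integral>t. (u t - h n t) * (u t - h n t) \<partial>M01) \<longlonglongrightarrow> (\<integral>t. 0 \<partial>M01)"
  proof (rule integral_dominated_convergence[where w = "\<lambda>_. 4 * B\<^sup>2"])
    show "(\<lambda>t. (u t - h n t) * (u t - h n t)) \<in> borel_measurable M01" for n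
      using u borel_measurable_M01I[OF borel_measurable_continuous_onI[OF h]] by measurable
    have "AE t in lebesgue. t \<notin> N"
      using N by (intro AE_not_in) (simp add: negligible_iff_null_sets)
    then have "AE t in lborel. t \<notin> N"
      by (simp add: AE_completion_iff)
    then have "AE t in M01. t \<notin> N \<and> t \<in> {0<..<1}"
      unfolding AE_M01_iff by eventually_elim simp
    then show "AE t in M01. (\<lambda>n. (u t - h n t) * (u t - h n t)) \<longlonglongrightarrow> 0"
    proof eventually_elim
      case (elim t)
      then have "(\<lambda>n. g n t) \<longlonglongrightarrow> u t"
        using lim[of t] by simp
      then have "(\<lambda>n. h n t) \<longlonglongrightarrow> max (- B) (min B (u t))"
        unfolding h_def by (intro tendsto_intros)
      also have "max (- B) (min B (u t)) = u t"
        using B[of t] by (simp add: abs_le_iff min_def max_def)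
      finally have "(\<lambda>n. (u t - h n t) * (u t - h n t)) \<longlonglongrightarrow> (u t - u t) * (u t - u t)"
        by (intro tendsto_intros)
      then show ?case by simp
    qed
    have "norm ((u t - h n t) * (u t - h n t)) \<le> 4 * B\<^sup>2" for n t
    proof -
      have "\<bar>u t - h n t\<bar> \<le> 2 * B"
        using B[of t] by (auto simp: h_def min_def max_def)
      then have "\<bar>u t - h n t\<bar>\<^sup>2 \<le> (2 * B)\<^sup>2"
        by (intro power_mono) auto
      then show ?thesis by (simp add: power2_eq_square)
    qed
    then show "AE t in M01. norm ((u t - h n t) * (u t - h n t)) \<le> 4 * B\<^sup>2" for n
      by simp
  qed auto
  then have "(\<lambda>n. ip (\<lambda>t. u t - h n t) (\<lambda>t. u t - h n t)) \<longlonglongrightarrow> 0"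
    by (simp add: ip_def)
  then have "\<forall>\<^sub>F n in sequentially. ip (\<lambda>t. u t - h n t) (\<lambda>t. u t - h n t) < e"
    using e by (rule order_tendstoD)
  then obtain n where "ip (\<lambda>t. u t - h n t) (\<lambda>t. u t - h n t) < e"
    by (auto simp: eventually_sequentially)
  then show ?thesis using h by blast
qed

text \<open>Truncate at height \<open>n\<close>: the error vanishes at each point for large
  \<open>n\<close>, and its square is dominated by that of \<open>r\<close>.\<close>

lemma bounded_dense_L2_01:
  assumes r: "r \<in> L2_01" and e: "0 < e"
  shows "\<exists>u B. u \<in> borel_measurable M01 \<and> (\<forall>t. \<bar>u t\<bar> \<le> B) \<and>
    ip (\<lambda>t. r t - u t) (\<lambda>t. r t - u t) < e"
proof -
  define u where "u n t = max (- real n) (min (real n) (r t))" for n t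
  have u: "u n \<in> borel_measurable M01" for n
    unfolding u_def using r by measurable
  have "(\<lambda>n. \<integral>t. (r t - u n t) * (r t - u n t) \<partial>M01) \<longlonglongrightarrow> (\<integral>t. 0 \<partial>M01)"
  proof (rule integral_dominated_convergence[where w = "\<lambda>t. (r t)\<^sup>2"])
    show "(\<lambda>t. (r t - u n t) * (r t - u n t)) \<in> borel_measurable M01" for n
      using r u by measurable
    show "integrable M01 (\<lambda>t. (r t)\<^sup>2)" using r by (simp add: L2_01_iff)
    have "(\<lambda>n. (r t - u n t) * (r t - u n t)) \<longlonglongrightarrow> 0" for t
    proof (rule tendsto_eventually)
      obtain m where m: "\<bar>r t\<bar> \<le> real m"
        using real_arch_simple by blast
      have "u n t = r t" if "n \<ge> m" for n
      proof -
        have "\<bar>r t\<bar> \<le> real n" using m that by simp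
        then show ?thesis by (simp add: u_def abs_le_iff min_def max_def)
      qed
      then show "\<forall>\<^sub>F n in sequentially. (r t - u n t) * (r t - u n t) = 0"
        by (auto simp: eventually_sequentially intro!: exI[of _ m])
    qed
    then show "AE t in M01. (\<lambda>n. (r t - u n t) * (r t - u n t)) \<longlonglongrightarrow> 0"
      by simp
    have "norm ((r t - u n t) * (r t - u n t)) \<le> (r t)\<^sup>2" for n t
    proof -
      have "\<bar>r t - u n t\<bar> \<le> \<bar>r t\<bar>"
        by (auto simp: u_def min_def max_def)
      then have "\<bar>r t - u n t\<bar>\<^sup>2 \<le> \<bar>r t\<bar>\<^sup>2"
        by (intro power_mono) auto
      then show ?thesis by (simp add: power2_eq_square)
    qed
    then show "AE t in M01. norm ((r t - u n t) * (r t - u n t)) \<le> (r t)\<^sup>2" for n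
      by simp
  qed auto
  then have "(\<lambda>n. ip (\<lambda>t. r t - u n t) (\<lambda>t. r t - u n t)) \<longlonglongrightarrow> 0"
    by (simp add: ip_def)
  then have "\<forall>\<^sub>F n in sequentially. ip (\<lambda>t. r t - u n t) (\<lambda>t. r t - u n t) < e"
    using e by (rule order_tendstoD)
  then obtain n where n: "ip (\<lambda>t. r t - u n t) (\<lambda>t. r t - u n t) < e"
    by (auto simp: eventually_sequentially)
  moreover have "\<bar>u n t\<bar> \<le> real n" for t
    by (auto simp: u_def min_def max_def)
  ultimately show ?thesis using u by blast
qed

lemma real_polynomial_function_poly:
  assumes "real_polynomial_function (f :: real \<Rightarrow> real)"
  obtains p where "f = poly p"
proof -
  obtain a n where "f = (\<lambda>x. \<Sum>i\<le>n. a i * x ^ i)"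
    using assms real_polynomial_function_iff_sum by blast
  then have "f = poly (\<Sum>i\<le>n. monom (a i) i)"
    by (simp add: poly_sum poly_monom fun_eq_iff)
  then show thesis by (rule that)
qed

lemma poly_antiderivative: "\<exists>P :: real poly. pderiv P = p \<and> poly P 0 = 0"
proof (intro exI conjI)
  let ?P = "\<Sum>i\<le>degree p. monom (coeff p i / real (Suc i)) (Suc i)"
  have "pderiv ?P = (\<Sum>i\<le>degree p. monom (coeff p i) i)"
    using higher_pderiv_sum[of 1 "\<lambda>i. monom (coeff p i / real (Suc i)) (Suc i)"]
    by (simp add: pderiv_monom del: of_nat_Suc)
  then show "pderiv ?P = p"
    by (simp add: poly_as_sum_of_monoms)
  show "poly ?P 0 = 0"
    by (simp add: poly_sum poly_monom)
qed

lemma polynomial_dense_L2_01: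
  assumes r: "r \<in> L2_01" and e: "0 < e"
  shows "\<exists>p. ip (\<lambda>t. r t - poly p t) (\<lambda>t. r t - poly p t) < e"
proof -
  \<comment> \<open>Two uses of \<open>ip_self_add_le\<close> weight the errors of truncation,
    continuous and polynomial approximation by 2, 4 and 4, so \<open>e / 16\<close> for each stays
    below \<open>e\<close> in total.\<close>
  obtain u B where u: "u \<in> borel_measurable M01" "\<And>t. \<bar>u t\<bar> \<le> B"
    and 1: "ip (\<lambda>t. r t - u t) (\<lambda>t. r t - u t) < e / 16"
    using bounded_dense_L2_01[OF r, of "e / 16"] e by auto
  obtain h where h: "continuous_on UNIV h"
    and 2: "ip (\<lambda>t. u t - h t) (\<lambda>t. u t - h t) < e / 16"
    using continuous_dense_L2_01_bounded[OF u, of "e / 16"] e by auto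
  obtain f where "real_polynomial_function f" and f: "\<And>t. t \<in> {0..1} \<Longrightarrow> \<bar>h t - f t\<bar> < sqrt (e / 16)"
    using Stone_Weierstrass_real_polynomial_function[of "{0..1::real}" h "sqrt (e / 16)"]
      continuous_on_subset[OF h] e by auto
  then obtain p where p: "f = poly p"
    using real_polynomial_function_poly by blast
  have L2: "u \<in> L2_01" "h \<in> L2_01" "poly p \<in> L2_01"
    using L2_01_bounded[OF u(1), of B] u(2) h by (auto intro!: L2_01_continuous continuous_intros)
  have 3: "ip (\<lambda>t. h t - poly p t) (\<lambda>t. h t - poly p t) \<le> (sqrt (e / 16))\<^sup>2"
    using f L2 unfolding p by (intro ip_self_le_bound L2_01_diff less_imp_le) auto
  have eq: "(\<lambda>t. r t - poly p t) = (\<lambda>t. (r t - u t) + ((u t - h t) + (h t - poly p t)))"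
    by auto
  have "ip (\<lambda>t. (r t - u t) + ((u t - h t) + (h t - poly p t))) (\<lambda>t. (r t - u t) + ((u t - h t) + (h t - poly p t)))
    \<le> 2 * ip (\<lambda>t. r t - u t) (\<lambda>t. r t - u t) +
      2 * ip (\<lambda>t. (u t - h t) + (h t - poly p t)) (\<lambda>t. (u t - h t) + (h t - poly p t))"
    using r L2 by (intro ip_self_add_le L2_01_add L2_01_diff)
  moreover have "ip (\<lambda>t. (u t - h t) + (h t - poly p t)) (\<lambda>t. (u t - h t) + (h t - poly p t))
    \<le> 2 * ip (\<lambda>t. u t - h t) (\<lambda>t. u t - h t) + 2 * ip (\<lambda>t. h t - poly p t) (\<lambda>t. h t - poly p t)"
    using r L2 by (intro ip_self_add_le L2_01_diff)
  ultimately have "ip (\<lambda>t. r t - poly p t) (\<lambda>t. r t - poly p t) < e"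
    unfolding eq using 1 2 3 e by (simp add: field_simps)
  then show ?thesis by blast
qed

subsection \<open>The dual ball of the total variation\<close>

text \<open>With \<open>w = e / H\<close>, this is the factor between the derivative of the cut-off
  \<open>G\<close> and that of \<open>G\<close>; its uniform bound provides the dominating function
  below.\<close>

lemma cutoff_factor_bounds:
  fixes w :: real
  assumes "0 \<le> w"
  shows "\<bar>exp (- w) * (1 + 2 * w + 2 * w\<^sup>2)\<bar> \<le> 4"
proof -
  have "1 + 2 * w + 2 * w\<^sup>2 \<le> 4 * exp w"
    using exp_lower_Taylor_quadratic[OF assms] assms by simp
  then have "exp (- w) * (1 + 2 * w + 2 * w\<^sup>2) \<le> exp (- w) * (4 * exp w)"
    by (intro mult_left_mono) auto
  also have "\<dots> = 4" by (simp add: exp_minus)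
  finally show ?thesis using assms by simp
qed

text \<open>\<open>G\<close> vanishes at the endpoints but need not have compact support in (0,1).
  Cutting it off where its square is at most \<open>e n\<close> gives admissible test functions,
  whose derivatives converge to that of \<open>G\<close> a.e. under a common integrable
  bound.\<close>

lemma ip_pderiv_le_of_TV_bound:
  assumes z: "z \<in> L2_01"
    and C: "\<And>\<phi>. \<phi> \<in> Cc_inf_01 \<Longrightarrow> (\<And>t. \<bar>\<phi> t\<bar> \<le> 1) \<Longrightarrow> ip z (deriv \<phi>) \<le> C"
    and G01: "poly G 0 = 0" "poly G 1 = 0" and G: "\<And>t. t \<in> {0..1} \<Longrightarrow> \<bar>poly G t\<bar> \<le> 1"
  shows "ip z (poly (pderiv G)) \<le> C"
proof (cases "G = 0")
  case True
  then show ?thesis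
    using C[OF zero_in_Cc_inf_01] by (simp add: ip_def)
next
  case False
  define e where "e n = (inverse (real (Suc n)))\<^sup>2" for n
  define H where "H n = G\<^sup>2 - [:e n:]" for n
  define \<phi> where "\<phi> n = cutoff (e n) (H n) 0 G" for n
  have e: "0 < e n" for n by (simp add: e_def)
  have e0: "e \<longlonglongrightarrow> 0"
    unfolding e_def using tendsto_power[OF LIMSEQ_inverse_real_of_nat, of 2] by simp
  have H: "poly (H n) 0 < 0" "poly (H n) 1 < 0" for n
    using e by (simp_all add: H_def G01)
  have Cc: "\<phi> n \<in> Cc_inf_01" for n
    unfolding \<phi>_def by (rule cutoff_Cc_inf_01[OF e H])
  have bd: "\<bar>\<phi> n t\<bar> \<le> 1" for n t
  proof (cases "0 < t \<and> t < 1 \<and> 0 < poly (H n) t")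
    case True
    then have "\<bar>poly G t\<bar> * exp (- e n / poly (H n) t) \<le> 1 * 1"
      using G[of t] e[of n] by (intro mult_mono) (auto simp: less_imp_le)
    then show ?thesis
      unfolding \<phi>_def cutoff_def if_P[OF True] by (simp add: abs_mult)
  next
    case False
    show ?thesis unfolding \<phi>_def cutoff_def if_not_P[OF False] by simp
  qed
  \<comment> \<open>Since \<open>H = G\<^sup>2 - e\<close>, the term
    \<open>2 * e * G\<^sup>2 / H\<^sup>2\<close> from the exponential becomes
    \<open>2 * w + 2 * w\<^sup>2\<close> with \<open>w = e / H\<close>.\<close>
  have deriv_in: "deriv (\<phi> n) t = poly (pderiv G) t *
      (exp (- (e n / poly (H n) t)) * (1 + 2 * (e n / poly (H n) t) + 2 * (e n / poly (H n) t)\<^sup>2))"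
    if t: "0 < t \<and> t < 1 \<and> 0 < poly (H n) t" for n t
  proof -
    let ?h = "poly (H n) t" and ?g = "poly G t" and ?g' = "poly (pderiv G) t"
    have g2: "?g\<^sup>2 = ?h + e n" by (simp add: H_def)
    have h': "poly (pderiv (H n)) t = 2 * ?g * ?g'"
      by (simp add: H_def power2_eq_square pderiv_diff pderiv_mult pderiv_pCons)
    have "deriv (\<phi> n) t = (?g' * ?h\<^sup>2 + e n * (?g * (2 * ?g * ?g'))) * exp (- e n / ?h) / ?h ^ (0 + 2)"
      unfolding \<phi>_def DERIV_imp_deriv[OF cutoff_DERIV[OF e H]] cutoff_def if_P[OF t]
      by (simp add: h')
    also have "?g * (2 * ?g * ?g') = 2 * (?h + e n) * ?g'"
      by (simp add: power2_eq_square flip: g2)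
    also have "(?g' * ?h\<^sup>2 + e n * (2 * (?h + e n) * ?g')) * exp (- e n / ?h) / ?h ^ (0 + 2) =
        ?g' * (exp (- (e n / ?h)) * (1 + 2 * (e n / ?h) + 2 * (e n / ?h)\<^sup>2))"
      using t by (simp add: power2_eq_square field_simps)
    finally show ?thesis .
  qed
  have deriv_out: "deriv (\<phi> n) t = 0"
    if t: "\<not> (0 < t \<and> t < 1 \<and> 0 < poly (H n) t)" for n t
    unfolding \<phi>_def DERIV_imp_deriv[OF cutoff_DERIV[OF e H]] cutoff_def if_not_P[OF t] ..
  have "(\<lambda>n. \<integral>t. z t * deriv (\<phi> n) t \<partial>M01) \<longlonglongrightarrow> (\<integral>t. z t * poly (pderiv G) t \<partial>M01)"
  proof (rule integral_dominated_convergence[where w = "\<lambda>t. 4 * \<bar>z t * poly (pderiv G) t\<bar>"])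
    have P: "poly (pderiv G) \<in> L2_01"
      by (intro L2_01_continuous continuous_intros)
    show "(\<lambda>t. z t * poly (pderiv G) t) \<in> borel_measurable M01"
      using z P by measurable
    show "(\<lambda>t. z t * deriv (\<phi> n) t) \<in> borel_measurable M01" for n
      using z Cc_inf_01_deriv_L2[OF Cc] by measurable
    show "integrable M01 (\<lambda>t. 4 * \<bar>z t * poly (pderiv G) t\<bar>)"
      using integrable_mult_L2_01[OF z P] by simp
    have "norm (z t * deriv (\<phi> n) t) \<le> 4 * \<bar>z t * poly (pderiv G) t\<bar>" for n t
    proof (cases "0 < t \<and> t < 1 \<and> 0 < poly (H n) t")
      case True
      define w where "w = e n / poly (H n) t"
      have "0 \<le> w" using True e[of n] by (simp add: w_def)
      have "norm (z t * deriv (\<phi> n) t) =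
          \<bar>z t * poly (pderiv G) t\<bar> * \<bar>exp (- w) * (1 + 2 * w + 2 * w\<^sup>2)\<bar>"
        unfolding deriv_in[OF True] w_def by (simp add: abs_mult mult.assoc)
      also have "\<dots> \<le> \<bar>z t * poly (pderiv G) t\<bar> * 4"
        using \<open>0 \<le> w\<close> by (intro mult_left_mono cutoff_factor_bounds) auto
      finally show ?thesis by simp
    next
      case False
      then show ?thesis using deriv_out by simp
    qed
    then show "AE t in M01. norm (z t * deriv (\<phi> n) t) \<le> 4 * \<bar>z t * poly (pderiv G) t\<bar>" for n
      by simp
    \<comment> \<open>A nonzero polynomial has finitely many roots. At any other point
      \<open>H n\<close> tends to a positive limit, so \<open>e n / H n\<close> tends to 0.\<close>
    have "AE t in M01. t \<notin> {t. poly G t = 0}"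
      using poly_roots_finite[OF False] by (rule AE_M01_notin_finite)
    then show "AE t in M01. (\<lambda>n. z t * deriv (\<phi> n) t) \<longlonglongrightarrow> z t * poly (pderiv G) t"
      using AE_space
    proof eventually_elim
      case (elim t)
      then have g: "(poly G t)\<^sup>2 > 0" and t: "0 < t" "t < 1" by auto
      have h: "(\<lambda>n. poly (H n) t) \<longlonglongrightarrow> (poly G t)\<^sup>2"
        unfolding H_def using tendsto_diff[OF tendsto_const e0, of "(poly G t)\<^sup>2"] by simp
      have w: "(\<lambda>n. e n / poly (H n) t) \<longlonglongrightarrow> 0"
        using tendsto_divide[OF e0 h] g by simp
      have "(\<lambda>n. z t * (poly (pderiv G) t * (exp (- (e n / poly (H n) t)) *
          (1 + 2 * (e n / poly (H n) t) + 2 * (e n / poly (H n) t)\<^sup>2))))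
        \<longlonglongrightarrow> z t * (poly (pderiv G) t * (exp (- 0) * (1 + 2 * 0 + 2 * 0\<^sup>2)))"
        by (intro tendsto_intros w)
      moreover have "\<forall>\<^sub>F n in sequentially. z t * (poly (pderiv G) t * (exp (- (e n / poly (H n) t)) *
          (1 + 2 * (e n / poly (H n) t) + 2 * (e n / poly (H n) t)\<^sup>2))) = z t * deriv (\<phi> n) t"
        using order_tendstoD(1)[OF h g] by eventually_elim (use t deriv_in in simp)
      ultimately show ?case
        by (auto intro: Lim_transform_eventually)
    qed
  qed
  then have "(\<lambda>n. ip z (deriv (\<phi> n))) \<longlonglongrightarrow> ip z (poly (pderiv G))"
    by (simp add: ip_def)
  then show ?thesis
    by (rule LIMSEQ_le_const2) (use C[OF Cc bd] in auto)
qed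

text \<open>The subdifferential of \<open>TV\<close> at 0, described through primitives because the
  comparison argument works with them pointwise. \<open>dual_ball_imp_le_TV\<close> and
  \<open>le_TV_imp_dual_ball\<close> give the equivalence with the pairing inequality.\<close>

definition dual_ball :: "(real \<Rightarrow> real) set" where
  "dual_ball = {r \<in> L2_01. (\<forall>t\<in>{0..1}. \<bar>ip r (indicator {..t})\<bar> \<le> 1) \<and> ip r (indicator {..1}) = 0}"

lemma ip_self_indicator_le: "ip (indicator {..t}) (indicator {..t}) \<le> 1"
  using ip_self_le_bound[of "indicator {..t}" 1] by (simp add: L2_01_indicator indicator_def)

text \<open>A polynomial \<open>p\<close> close to \<open>r\<close> in the mean has a primitive
  uniformly close to that of \<open>r\<close>. A linear correction restores the zero at 1, and
  rescaling restores the bound 1.\<close>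

lemma dual_ball_approx:
  assumes r: "r \<in> dual_ball" and z: "z \<in> L2_01"
    and C: "\<And>\<phi>. \<phi> \<in> Cc_inf_01 \<Longrightarrow> (\<And>t. \<bar>\<phi> t\<bar> \<le> 1) \<Longrightarrow> ip z (deriv \<phi>) \<le> C"
    and e: "0 < e"
  shows "ip r z \<le> (1 + 2 * e) * C + 2 * e * sqrt (ip z z)"
proof -
  have rL2: "r \<in> L2_01" and r1: "ip r (indicator {..1}) = 0"
    and rb: "\<And>t. t \<in> {0..1} \<Longrightarrow> \<bar>ip r (indicator {..t})\<bar> \<le> 1"
    using r by (auto simp: dual_ball_def)
  obtain p where p: "ip (\<lambda>t. r t - poly p t) (\<lambda>t. r t - poly p t) < e\<^sup>2"
    using polynomial_dense_L2_01[OF rL2, of "e\<^sup>2"] e by auto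
  obtain P where P: "pderiv P = p" "poly P 0 = 0"
    using poly_antiderivative by blast
  have pL2: "poly p \<in> L2_01"
    by (intro L2_01_continuous continuous_intros)
  have dL2: "(\<lambda>t. r t - poly p t) \<in> L2_01"
    using rL2 pL2 by (rule L2_01_diff)
  have "sqrt (ip (\<lambda>t. r t - poly p t) (\<lambda>t. r t - poly p t)) < sqrt (e\<^sup>2)"
    using p by (rule real_sqrt_less_mono)
  then have d: "sqrt (ip (\<lambda>t. r t - poly p t) (\<lambda>t. r t - poly p t)) \<le> e"
    using e by simp
  have dip: "\<bar>ip r v - ip (poly p) v\<bar> \<le> e * sqrt (ip v v)" if "v \<in> L2_01" for v
  proof -
    have "\<bar>ip (\<lambda>t. r t - poly p t) v\<bar> \<le>
        sqrt (ip (\<lambda>t. r t - poly p t) (\<lambda>t. r t - poly p t)) * sqrt (ip v v)"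
      using dL2 that by (rule ip_Cauchy_Schwarz)
    also have "\<dots> \<le> e * sqrt (ip v v)"
      using d by (intro mult_right_mono) (auto simp: ip_self_nonneg)
    finally show ?thesis
      using rL2 pL2 that by (simp add: ip_diff_left)
  qed
  have Pt: "\<bar>ip r (indicator {..t}) - poly P t\<bar> \<le> e" if t: "t \<in> {0..1}" for t
  proof -
    have "ip (poly p) (indicator {..t}) = poly P t"
      using ip_indicator_atMost_FTC[of t "poly P" "poly p"] t P poly_DERIV[of P]
        continuous_on_poly[OF continuous_on_id, of UNIV p]
      by simp
    moreover have "e * sqrt (ip (indicator {..t}) (indicator {..t})) \<le> e"
      using ip_self_indicator_le[of t] e by (simp add: mult_left_le)
    ultimately show ?thesis
      using dip[of "indicator {..t}"] by (simp add: L2_01_indicator)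
  qed
  \<comment> \<open>The summand 1 bounds the primitive of \<open>r\<close>; one \<open>e\<close> is
    the error of \<open>P\<close>, the other the size of the linear correction.\<close>
  define M where "M = 1 + 2 * e"
  have M: "M > 0" using e by (simp add: M_def)
  define c where "c = poly P 1"
  have c: "\<bar>c\<bar> \<le> e" using Pt[of 1] r1 by (simp add: c_def)
  define G where "G = smult (1 / M) (P - [:0, c:])"
  have "\<bar>poly G t\<bar> \<le> 1" if t: "t \<in> {0..1}" for t
  proof -
    have "\<bar>t * c\<bar> \<le> 1 * e"
      unfolding abs_mult using t c by (intro mult_mono) auto
    then have "\<bar>poly P t - t * c\<bar> \<le> M"
      using rb[OF t] Pt[OF t] by (simp add: M_def abs_le_iff)
    then show ?thesis using M by (simp add: G_def abs_mult)
  qed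
  then have "ip z (poly (pderiv G)) \<le> C"
    by (intro ip_pderiv_le_of_TV_bound[OF z C]) (auto simp: G_def P c_def)
  also have "poly (pderiv G) = (\<lambda>t. (1 / M) * (poly p t - c))"
    by (simp add: G_def pderiv_smult pderiv_diff pderiv_pCons P fun_eq_iff)
  finally have "ip z (\<lambda>t. poly p t - c) \<le> M * C"
    unfolding ip_cmult_right using M by (simp add: field_simps)
  moreover have one: "(\<lambda>_. 1) \<in> L2_01" "(\<lambda>_. c) \<in> L2_01"
    by (intro L2_01_continuous continuous_intros)+
  moreover have "ip z (\<lambda>_. c) = c * ip z (\<lambda>_. 1)"
    using ip_cmult_right[of z c "\<lambda>_. 1"] by simp
  ultimately have 1: "ip (poly p) z - c * ip z (\<lambda>_. 1) \<le> M * C"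
    using z pL2 by (simp add: ip_diff_right ip_commute[of z "poly p"])
  have "\<bar>ip z (\<lambda>_. 1)\<bar> \<le> sqrt (ip z z) * sqrt (ip (\<lambda>_. 1) (\<lambda>_. 1))"
    using z one by (intro ip_Cauchy_Schwarz)
  also have "\<dots> \<le> sqrt (ip z z) * 1"
    using ip_self_le_bound[OF one(1), of 1] by (intro mult_left_mono) (auto simp: ip_self_nonneg)
  finally have "\<bar>c * ip z (\<lambda>_. 1)\<bar> \<le> e * sqrt (ip z z)"
    unfolding abs_mult using c e by (intro mult_mono) auto
  then show ?thesis
    using 1 dip[OF z] by (simp add: M_def abs_le_iff)
qed

lemma dual_ball_imp_le_TV:
  assumes r: "r \<in> dual_ball" and z: "z \<in> L2_01"
  shows "ereal (ip r z) \<le> TV z"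
proof (cases "TV z")
  case (real C)
  have C: "ip z (deriv \<phi>) \<le> C" if "\<phi> \<in> Cc_inf_01" "\<And>t. \<bar>\<phi> t\<bar> \<le> 1" for \<phi>
    using TV_upper[OF that, of z] real by simp
  have "ip r z \<le> C"
  proof (rule tendsto_lowerbound)
    show "((\<lambda>e. (1 + 2 * e) * C + 2 * e * sqrt (ip z z)) \<longlongrightarrow> C) (at_right 0)"
      by (rule tendsto_eq_intros refl | simp)+
    show "\<forall>\<^sub>F e in at_right 0. ip r z \<le> (1 + 2 * e) * C + 2 * e * sqrt (ip z z)"
      using dual_ball_approx[OF r z C] by (auto simp: eventually_at_right_less intro: eventually_at_rightI[of 0 1])
  qed simp
  then show ?thesis using real by simp
next
  case MInf
  then show ?thesis using TV_nonneg[of z] by simp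
qed simp

text \<open>Test with step functions of height 1 and -1.\<close>

lemma le_TV_imp_dual_ball:
  assumes r: "r \<in> L2_01" and le: "\<And>z. z \<in> L2_01 \<Longrightarrow> ereal (ip r z) \<le> TV z"
  shows "r \<in> dual_ball"
proof -
  have *: "ereal (c * ip r (indicator {..t})) \<le> TV (\<lambda>s. c * indicator {..t} s)" for c t
    using le[of "\<lambda>s. c * indicator {..t} s"] by (simp add: ip_cmult_right L2_01_cmult L2_01_indicator)
  have "\<bar>ip r (indicator {..t})\<bar> \<le> 1" if "t \<in> {0..1}" for t
    using order_trans[OF * TV_indicator_atMost, of t 1] order_trans[OF * TV_indicator_atMost, of t "-1"] that
    by (simp add: abs_le_iff)
  moreover have "ip r (indicator {..1}) = 0"
    using order_trans[OF * TV_indicator_atMost_1, of 1] order_trans[OF * TV_indicator_atMost_1, of "-1"]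
    by simp
  ultimately show ?thesis using r by (simp add: dual_ball_def)
qed

subsection \<open>Comparison of primitives and the iteration\<close>

text \<open>Dominated convergence: the indicators converge at every point except possibly the jump
  \<open>a\<close>.\<close>

lemma continuous_on_primitive:
  assumes r: "r \<in> L2_01"
  shows "continuous_on S (\<lambda>t. ip r (indicator {..t}))"
proof (rule continuous_at_imp_continuous_on, rule ballI, rule continuous_at_sequentiallyI)
  fix a :: real and u :: "nat \<Rightarrow> real"
  assume u: "u \<longlonglongrightarrow> a"
  have one: "(\<lambda>_. 1) \<in> L2_01"
    by (intro L2_01_continuous continuous_intros)
  show "(\<lambda>n. ip r (indicator {..u n})) \<longlonglongrightarrow> ip r (indicator {..a})"
    unfolding ip_def
  proof (rule integral_dominated_convergence[where w = "\<lambda>s. \<bar>r s\<bar>"])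
    show "(\<lambda>s. r s * indicator {..a} s) \<in> borel_measurable M01"
      "\<And>n. (\<lambda>s. r s * indicator {..u n} s) \<in> borel_measurable M01"
      using L2_01_restrict[OF r] L2_01_measurable by auto
    show "integrable M01 (\<lambda>s. \<bar>r s\<bar>)"
      using integrable_mult_L2_01[OF r one] by simp
    show "AE s in M01. norm (r s * indicator {..u n} s) \<le> \<bar>r s\<bar>" for n
      by (simp add: indicator_def)
    have "AE s in M01. s \<notin> {a}" by (rule AE_M01_notin_finite) simp
    then show "AE s in M01. (\<lambda>n. r s * indicator {..u n} s) \<longlonglongrightarrow> r s * indicator {..a} s"
    proof eventually_elim
      case (elim s)
      have "\<forall>\<^sub>F n in sequentially. r s * indicator {..u n} s = r s * indicator {..a} s"
      proof (cases "s < a")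
        case True
        show ?thesis
          using order_tendstoD(1)[OF u True] by eventually_elim (use True in \<open>auto simp: indicator_def\<close>)
      next
        case False
        with elim have "a < s" by simp
        show ?thesis
          using order_tendstoD(2)[OF u \<open>a < s\<close>]
          by eventually_elim (use \<open>a < s\<close> in \<open>auto simp: indicator_def\<close>)
      qed
      then show ?case by (rule tendsto_eventually)
    qed
  qed
qed

text \<open>Take the largest zero, which exists by compactness. A negative value after it would
  produce a later zero by the intermediate value theorem.\<close>

lemma last_zero_before:
  fixes F :: "real \<Rightarrow> real"
  assumes F: "continuous_on {a..b} F" and ab: "a \<le> b" and s: "F a \<le> 0" "0 \<le> F b"
  obtains c where "c \<in> {a..b}" "F c = 0" "\<And>t. t \<in> {c..b} \<Longrightarrow> 0 \<le> F t"
proof -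
  define Z where "Z = {a..b} \<inter> F -` {0}"
  have "closed Z"
    unfolding Z_def by (intro continuous_closed_preimage F) auto
  then have "compact Z"
    unfolding compact_eq_bounded_closed by (auto simp: Z_def intro: bounded_subset[of "{a..b}"])
  moreover have "Z \<noteq> {}"
    using IVT'[of F a 0 b] s ab F by (auto simp: Z_def)
  ultimately obtain c where c: "c \<in> Z" "\<And>t. t \<in> Z \<Longrightarrow> t \<le> c"
    by (meson compact_attains_sup)
  have "0 \<le> F t" if t: "t \<in> {c..b}" for t
  proof (rule ccontr)
    assume neg: "\<not> 0 \<le> F t"
    have "continuous_on {t..b} F"
      by (rule continuous_on_subset[OF F]) (use t c in \<open>auto simp: Z_def\<close>)
    then obtain t' where "t \<le> t'" "t' \<le> b" "F t' = 0"
      using IVT'[of F t 0 b] neg t s by auto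
    then have "t' \<le> c" using c t by (auto simp: Z_def)
    then have "t = c" using t \<open>t \<le> t'\<close> by auto
    then show False using neg c by (simp add: Z_def)
  qed
  with c show thesis by (intro that[of c]) (auto simp: Z_def)
qed

text \<open>Reflect the line and apply \<open>last_zero_before\<close>.\<close>

lemma first_zero_after:
  fixes F :: "real \<Rightarrow> real"
  assumes F: "continuous_on {a..b} F" and ab: "a \<le> b" and s: "0 \<le> F a" "F b \<le> 0"
  obtains c where "c \<in> {a..b}" "F c = 0" "\<And>t. t \<in> {a..c} \<Longrightarrow> 0 \<le> F t"
proof -
  have "continuous_on {- b..- a} (\<lambda>t. F (- t))"
    by (rule continuous_on_compose2[OF F]) (auto intro!: continuous_intros)
  then obtain c where c: "c \<in> {- b..- a}" "F (- c) = 0" "\<And>t. t \<in> {c..- a} \<Longrightarrow> 0 \<le> F (- t)"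
    using last_zero_before[of "- b" "- a" "\<lambda>t. F (- t)"] ab s by auto
  then show thesis
    using c(3)[of "- t" for t] by (intro that[of "- c"]) auto
qed

lemma dual_ball_uminus:
  assumes "r \<in> dual_ball"
  shows "(\<lambda>t. - r t) \<in> dual_ball"
proof -
  have "ip (\<lambda>t. - r t) v = - ip r v" for v
    using ip_cmult_left[of "-1" r v] by simp
  then show ?thesis
    using assms L2_01_cmult[of r "-1"] by (simp add: dual_ball_def)
qed

text \<open>If the bound fails at some point, lift the primitive of \<open>q\<close> to the obstacle on a
  surrounding interval where it lies below it; the lifted competitor contradicts maximality.\<close>

lemma obstacle_comparison:
  assumes p: "p \<in> dual_ball" and q: "q \<in> dual_ball" and s: "1 \<le> s"
    and max: "\<And>r. r \<in> dual_ball \<Longrightarrow> ip r (\<lambda>t. s * p t - q t) \<le> ip q (\<lambda>t. s * p t - q t)"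
    and t0: "t0 \<in> {0..1}"
  shows "s * ip p (indicator {..t0}) - (s - 1) \<le> ip q (indicator {..t0})"
proof (rule ccontr)
  assume neg: "\<not> ?thesis"
  have pL2: "p \<in> L2_01" and qL2: "q \<in> L2_01"
    using p q by (auto simp: dual_ball_def)
  define f where "f t = s * p t - q t" for t
  have fL2: "f \<in> L2_01"
    unfolding f_def using L2_01_lincomb[OF pL2 qL2, of s "-1"] by simp
  \<comment> \<open>The height of the lower obstacle above the primitive of \<open>q\<close>; a
    positive value is a violation. It is nonpositive at 0 and 1 because
    \<open>s \<ge> 1\<close>.\<close>
  define F where "F t = ip f (indicator {..t}) - (s - 1)" for t
  have F: "F t = s * ip p (indicator {..t}) - ip q (indicator {..t}) - (s - 1)" for t
    unfolding F_def f_def using ip_lincomb_left[OF pL2 qL2 L2_01_indicator, of "{..t}" s "-1"] by simp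
  have cont: "continuous_on S F" for S
    unfolding F_def by (intro continuous_intros continuous_on_primitive fL2)
  have "ip f (indicator {..0}) = (\<integral>t. 0 \<partial>M01)"
    unfolding ip_def by (rule Bochner_Integration.integral_cong) auto
  then have F0: "F 0 \<le> 0" using s by (simp add: F_def)
  have F1: "F 1 \<le> 0" using s p q by (simp add: F dual_ball_def)
  have Ft0: "0 < F t0" using neg by (simp add: F)
  obtain \<alpha> where \<alpha>: "\<alpha> \<in> {0..t0}" "F \<alpha> = 0" "\<And>t. t \<in> {\<alpha>..t0} \<Longrightarrow> 0 \<le> F t"
    using last_zero_before[OF cont, of 0 t0] F0 Ft0 t0 by auto
  obtain \<beta> where \<beta>: "\<beta> \<in> {t0..1}" "F \<beta> = 0" "\<And>t. t \<in> {t0..\<beta>} \<Longrightarrow> 0 \<le> F t"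
    using first_zero_after[OF cont, of t0 1] F1 Ft0 t0 by auto
  \<comment> \<open>As \<open>F\<close> vanishes at \<alpha> and \<beta>, the primitive of
    \<open>g\<close> is \<open>F\<close> between them and 0 elsewhere: adding \<open>g\<close> to
    \<open>q\<close> lifts its primitive exactly to the obstacle.\<close>
  define g where "g t = f t * indicator {\<alpha><..\<beta>} t" for t
  have gL2: "g \<in> L2_01"
    unfolding g_def by (rule L2_01_restrict[OF fL2]) simp
  have "ip g (indicator {..t}) = ip f (\<lambda>x. indicator {..min t \<beta>} x - indicator {..min t \<alpha>} x)" for t
    unfolding ip_def g_def
    by (rule Bochner_Integration.integral_cong) (use \<alpha> \<beta> in \<open>auto simp: indicator_def\<close>)
  then have gint: "ip g (indicator {..t}) = F (min t \<beta>) - F (min t \<alpha>)" for t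
    using fL2 by (simp add: ip_diff_right L2_01_indicator F_def)
  have "(\<lambda>t. q t + g t) \<in> dual_ball"
  proof -
    have R: "ip (\<lambda>t. q t + g t) (indicator {..t}) = ip q (indicator {..t}) + (F (min t \<beta>) - F (min t \<alpha>))" for t
      using gL2 qL2 by (simp add: ip_add_left L2_01_indicator gint)
    have "\<bar>ip (\<lambda>t. q t + g t) (indicator {..t})\<bar> \<le> 1" if t: "t \<in> {0..1}" for t
    proof -
      have V: "\<bar>ip q (indicator {..t})\<bar> \<le> 1" and W: "\<bar>ip p (indicator {..t})\<bar> \<le> 1"
        using p q t by (auto simp: dual_ball_def)
      consider "t \<le> \<alpha>" | "\<alpha> \<le> t" "t \<le> \<beta>" | "\<beta> \<le> t" by linarith
      then show ?thesis
      proof cases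
        case 1
        then show ?thesis using V \<alpha> \<beta> by (simp add: R min_def)
      next
        case 2
        have "0 \<le> F t" using \<alpha>(3)[of t] \<beta>(3)[of t] 2 by (cases "t \<le> t0") auto
        have eq: "ip (\<lambda>t. q t + g t) (indicator {..t}) = ip q (indicator {..t}) + F t"
          using 2 \<alpha> by (simp add: R min_def)
        \<comment> \<open>The obstacle itself never exceeds \<open>s * 1 - (s - 1) = 1\<close>, so
          the lift respects the upper bound.\<close>
        have "s * ip p (indicator {..t}) \<le> s * 1"
          using W s by (intro mult_left_mono) auto
        then have "ip q (indicator {..t}) + F t \<le> 1"
          by (simp add: F)
        then show ?thesis
          using eq V \<open>0 \<le> F t\<close> by (simp add: abs_le_iff)
      next
        case 3
        then show ?thesis using V \<alpha> \<beta> by (auto simp: R min_def)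
      qed
    qed
    moreover have "ip (\<lambda>t. q t + g t) (indicator {..1}) = 0"
      unfolding R using q \<alpha>(1,2) \<beta>(1,2) by (simp add: dual_ball_def min.absorb2)
    ultimately show ?thesis
      using L2_01_add[OF qL2 gL2] by (simp add: dual_ball_def)
  qed
  \<comment> \<open>Maximality bounds \<open>ip g f\<close>, which is the squared norm of
    \<open>g\<close>, by 0. So the primitive of \<open>g\<close> vanishes, although at
    \<open>t0\<close> it equals \<open>F t0 > 0\<close>.\<close>
  from max[OF this] have "ip g f \<le> 0"
    unfolding f_def[symmetric] using qL2 gL2 fL2 by (simp add: ip_add_left)
  moreover have "ip g f = ip g g"
    unfolding ip_def g_def by (rule Bochner_Integration.integral_cong) (auto simp: indicator_def)
  ultimately have "ip g g = 0"
    using ip_self_nonneg[of g] by simp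
  then have "ip g (indicator {..t0}) = 0"
    using ip_Cauchy_Schwarz[OF gL2 L2_01_indicator, of "{..t0}"] by simp
  then have "F (min t0 \<beta>) - F (min t0 \<alpha>) = 0"
    by (simp only: gint)
  then show False
    using \<alpha> \<beta> Ft0 by (simp add: min_def split: if_splits)
qed

section \<open>First-order optimality conditions for TV-denoising\<close>

text \<open>Compare \<open>x\<close> with \<open>x + h w\<close>, divide by \<open>h\<close> and let
  \<open>h\<close> tend to 0 from the right; \<open>K\<close> is an upper bound for the slope of
  \<open>TV\<close> at \<open>x\<close> in direction \<open>w\<close>.\<close>

lemma tik_minimizer_directional:
  assumes y: "y \<in> L2_01" and lam: "0 < lam" and x: "is_tik_minimizer lam y x"
    and J: "TV x = ereal J" and w: "w \<in> L2_01"
    and K: "\<And>h. 0 < h \<Longrightarrow> h < 1 \<Longrightarrow> TV (\<lambda>t. x t + h * w t) \<le> ereal (J + h * K)"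
  shows "ip (\<lambda>t. lam * (y t - x t)) w \<le> K"
proof -
  have xL2: "x \<in> L2_01" using x by (simp add: is_tik_minimizer_def)
  have xy: "(\<lambda>t. x t - y t) \<in> L2_01" using xL2 y by (rule L2_01_diff)
  have "ip (\<lambda>t. lam * (y t - x t)) w \<le> K + h * (lam / 2 * ip w w)" if h: "0 < h" "h < 1" for h
  proof -
    have "(\<lambda>t. x t + h * w t) \<in> L2_01"
      using L2_01_lincomb[OF xL2 w, of 1 h] by simp
    then have "ereal (lam / 2 * L2_dist_sq x y) + TV x
        \<le> ereal (lam / 2 * L2_dist_sq (\<lambda>t. x t + h * w t) y) + TV (\<lambda>t. x t + h * w t)"
      using x by (auto simp: is_tik_minimizer_def tik_functional_def)
    also have "\<dots> \<le> ereal (lam / 2 * L2_dist_sq (\<lambda>t. x t + h * w t) y) + ereal (J + h * K)"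
      by (intro add_left_mono K h)
    finally have 1: "lam / 2 * L2_dist_sq x y \<le> lam / 2 * L2_dist_sq (\<lambda>t. x t + h * w t) y + h * K"
      by (simp add: J)
    have "L2_dist_sq (\<lambda>t. x t + h * w t) y =
        ip (\<lambda>t. 1 * (x t - y t) + h * w t) (\<lambda>t. 1 * (x t - y t) + h * w t)"
      unfolding L2_dist_sq_eq_ip by (simp add: algebra_simps)
    also have "\<dots> = L2_dist_sq x y + 2 * h * ip (\<lambda>t. x t - y t) w + h\<^sup>2 * ip w w"
      unfolding ip_self_lincomb[OF xy w] L2_dist_sq_eq_ip by simp
    finally have 2: "L2_dist_sq (\<lambda>t. x t + h * w t) y =
        L2_dist_sq x y + 2 * h * ip (\<lambda>t. x t - y t) w + h\<^sup>2 * ip w w" .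
    have 3: "ip (\<lambda>t. lam * (y t - x t)) w = - (lam * ip (\<lambda>t. x t - y t) w)"
      using xL2 y w unfolding ip_cmult_left by (simp add: ip_diff_left algebra_simps)
    have "h * ip (\<lambda>t. lam * (y t - x t)) w \<le> h * (K + h * (lam / 2 * ip w w))"
      using 1 unfolding 2 3 by (simp add: algebra_simps power2_eq_square)
    then show ?thesis using h by simp
  qed
  then have "\<forall>\<^sub>F h in at_right 0. ip (\<lambda>t. lam * (y t - x t)) w \<le> K + h * (lam / 2 * ip w w)"
    by (intro eventually_at_rightI[of 0 1]) auto
  moreover have "((\<lambda>h. K + h * (lam / 2 * ip w w)) \<longlongrightarrow> K) (at_right 0)"
    by (rule tendsto_eq_intros refl | simp)+
  ultimately show ?thesis
    by (intro tendsto_lowerbound) auto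
qed

lemma tik_minimizer_imp_dual:
  assumes y: "y \<in> L2_01" and lam: "0 < lam" and x: "is_tik_minimizer lam y x"
  shows "(\<lambda>t. lam * (y t - x t)) \<in> dual_ball"
    and "TV x = ereal (ip (\<lambda>t. lam * (y t - x t)) x)"
proof -
  let ?q = "\<lambda>t. lam * (y t - x t)"
  have xL2: "x \<in> L2_01" using x by (simp add: is_tik_minimizer_def)
  \<comment> \<open>Comparison with the zero function shows that \<open>TV x\<close> is
    finite.\<close>
  have "TV (\<lambda>t. 0) \<le> 0"
    using TV_cmult_le[of 0 x] by (simp flip: zero_ereal_def)
  have "(\<lambda>_. 0) \<in> L2_01"
    by (intro L2_01_continuous continuous_intros)
  then have "ereal (lam / 2 * L2_dist_sq x y) + TV x \<le> ereal (lam / 2 * L2_dist_sq (\<lambda>_. 0) y) + TV (\<lambda>_. 0)"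
    using x by (auto simp: is_tik_minimizer_def tik_functional_def)
  also have "\<dots> \<le> ereal (lam / 2 * L2_dist_sq (\<lambda>_. 0) y) + 0"
    by (intro add_left_mono) fact
  finally have "TV x \<noteq> \<infinity>" by auto
  then obtain J where J: "TV x = ereal J"
    using TV_nonneg[of x] by (cases "TV x") auto
  have le: "ereal (ip ?q w) \<le> TV w" if w: "w \<in> L2_01" for w
  proof (cases "TV w")
    case (real K)
    have "ip ?q w \<le> K"
    proof (rule tik_minimizer_directional[OF y lam x J w])
      fix h :: real assume h: "0 < h" "h < 1"
      have "TV (\<lambda>t. x t + h * w t) \<le> TV x + TV (\<lambda>t. h * w t)"
        by (rule TV_triangle[OF xL2 L2_01_cmult[OF w]])
      also have "\<dots> \<le> TV x + ereal h * TV w"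
        using h by (intro add_left_mono TV_cmult_le) simp
      finally show "TV (\<lambda>t. x t + h * w t) \<le> ereal (J + h * K)"
        by (simp add: real J)
    qed
    then show ?thesis by (simp add: real)
  next
    case MInf
    then show ?thesis using TV_nonneg[of w] by simp
  qed simp
  then show "?q \<in> dual_ball"
    by (intro le_TV_imp_dual_ball L2_01_cmult L2_01_diff y xL2)
  \<comment> \<open>In direction \<open>-x\<close>, homogeneity gives the slope \<open>-J\<close>;
    this is the reverse inequality needed for equality.\<close>
  have "ip ?q (\<lambda>t. (-1) * x t) \<le> - J"
  proof (rule tik_minimizer_directional[OF y lam x J])
    show "(\<lambda>t. (-1) * x t) \<in> L2_01" by (rule L2_01_cmult[OF xL2])
    fix h :: real assume h: "0 < h" "h < 1"
    have "TV (\<lambda>t. (1 - h) * x t) \<le> ereal (1 - h) * TV x"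
      using h by (intro TV_cmult_le) simp
    then show "TV (\<lambda>t. x t + h * ((-1) * x t)) \<le> ereal (J + h * (- J))"
      by (simp add: J algebra_simps)
  qed
  then have "J \<le> ip ?q x"
    unfolding ip_cmult_right by simp
  then show "TV x = ereal (ip ?q x)"
    using le[OF xL2] by (simp add: J)
qed

text \<open>Expand the squared distance of \<open>z\<close> to \<open>y\<close> around
  \<open>x\<close>, drop the square of \<open>z - x\<close>, and use that the pairing with the dual
  element is at most \<open>TV z\<close>.\<close>

lemma dual_imp_tik_minimizer:
  assumes y: "y \<in> L2_01" and lam: "0 < lam" and x: "x \<in> L2_01"
    and q: "(\<lambda>t. lam * (y t - x t)) \<in> dual_ball"
    and TV: "TV x \<le> ereal (ip (\<lambda>t. lam * (y t - x t)) x)"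
  shows "is_tik_minimizer lam y x"
  unfolding is_tik_minimizer_def tik_functional_def
proof (intro conjI ballI x)
  fix z assume z: "z \<in> L2_01"
  let ?q = "\<lambda>t. lam * (y t - x t)"
  have xy: "(\<lambda>t. x t - y t) \<in> L2_01" and zx: "(\<lambda>t. z t - x t) \<in> L2_01"
    using x y z by (auto intro: L2_01_diff)
  have "L2_dist_sq z y = ip (\<lambda>t. 1 * (x t - y t) + 1 * (z t - x t)) (\<lambda>t. 1 * (x t - y t) + 1 * (z t - x t))"
    unfolding L2_dist_sq_eq_ip by simp
  also have "\<dots> = L2_dist_sq x y + 2 * ip (\<lambda>t. x t - y t) (\<lambda>t. z t - x t) +
      ip (\<lambda>t. z t - x t) (\<lambda>t. z t - x t)"
    unfolding ip_self_lincomb[OF xy zx] L2_dist_sq_eq_ip by simp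
  finally have 1: "L2_dist_sq x y + 2 * ip (\<lambda>t. x t - y t) (\<lambda>t. z t - x t) \<le> L2_dist_sq z y"
    using ip_self_nonneg[of "\<lambda>t. z t - x t"] by simp
  have "ip ?q z - ip ?q x = - (lam * ip (\<lambda>t. x t - y t) (\<lambda>t. z t - x t))"
    using x y z zx unfolding ip_cmult_left by (simp add: ip_diff_left ip_diff_right algebra_simps)
  moreover have "lam / 2 * (L2_dist_sq x y + 2 * ip (\<lambda>t. x t - y t) (\<lambda>t. z t - x t)) \<le> lam / 2 * L2_dist_sq z y"
    using 1 lam by (intro mult_left_mono) auto
  ultimately have 2: "lam / 2 * L2_dist_sq x y + ip ?q x \<le> lam / 2 * L2_dist_sq z y + ip ?q z"
    by (simp add: algebra_simps)
  have "ereal (lam / 2 * L2_dist_sq x y) + TV x \<le> ereal (lam / 2 * L2_dist_sq x y) + ereal (ip ?q x)"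
    by (intro add_left_mono TV)
  also have "\<dots> \<le> ereal (lam / 2 * L2_dist_sq z y) + ereal (ip ?q z)"
    using 2 by simp
  also have "\<dots> \<le> ereal (lam / 2 * L2_dist_sq z y) + TV z"
    by (intro add_left_mono dual_ball_imp_le_TV q z)
  finally show "ereal (lam / 2 * L2_dist_sq x y) + TV x \<le> ereal (lam / 2 * L2_dist_sq z y) + TV z" .
qed

section \<open>The MHDM step\<close>

text \<open>Shifting competitors by \<open>a\<close> turns the step into denoising of the residual
  \<open>y - a\<close>, so the optimality conditions apply to the increment.\<close>

lemma mhdm_step_imp_tik_minimizer_residual:
  assumes a: "a \<in> L2_01" and x: "is_mhdm_step lam y a x"
  shows "is_tik_minimizer lam (\<lambda>t. y t - a t) (\<lambda>t. x t - a t)"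
  unfolding is_tik_minimizer_def
proof (intro conjI ballI)
  show "(\<lambda>t. x t - a t) \<in> L2_01"
    using x a by (auto simp: is_mhdm_step_def intro: L2_01_diff)
  fix z assume z: "z \<in> L2_01"
  have "mhdm_functional lam y a x \<le> mhdm_functional lam y a (\<lambda>t. z t + a t)"
    using x L2_01_add[OF z a] by (simp add: is_mhdm_step_def)
  then show "tik_functional lam (\<lambda>t. y t - a t) (\<lambda>t. x t - a t) \<le> tik_functional lam (\<lambda>t. y t - a t) z"
    by (simp add: mhdm_functional_def tik_functional_def L2_dist_sq_def algebra_simps)
qed

lemma mhdm_step_tik_minimizer:
  assumes y: "y \<in> L2_01" and mu: "0 < mu" "mu \<le> lam"
    and a: "is_tik_minimizer mu y a" and x: "is_mhdm_step lam y a x"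
  shows "is_tik_minimizer lam y x"
proof -
  define s where "s = lam / mu"
  have lam: "0 < lam" and s: "1 \<le> s" using mu by (auto simp: s_def)
  have aL2: "a \<in> L2_01" and xL2: "x \<in> L2_01"
    using a x by (auto simp: is_tik_minimizer_def is_mhdm_step_def)
  define p where "p t = mu * (y t - a t)" for t
  define q where "q t = lam * (y t - x t)" for t
  have p: "p \<in> dual_ball" and TVa: "TV a = ereal (ip p a)"
    unfolding p_def using tik_minimizer_imp_dual[OF y mu(1) a] by auto
  have q: "q \<in> dual_ball" and TVd: "TV (\<lambda>t. x t - a t) = ereal (ip q (\<lambda>t. x t - a t))"
    unfolding q_def
    using tik_minimizer_imp_dual[OF L2_01_diff[OF y aL2] lam mhdm_step_imp_tik_minimizer_residual[OF aL2 x]]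
    by simp_all
  have pL2: "p \<in> L2_01" and qL2: "q \<in> L2_01"
    using p q by (auto simp: dual_ball_def)
  have d: "(\<lambda>t. s * p t - q t) = (\<lambda>t. lam * (x t - a t))"
    using mu by (auto simp: s_def p_def q_def field_simps)
  have dL2: "(\<lambda>t. x t - a t) \<in> L2_01" using xL2 aL2 by (rule L2_01_diff)
  \<comment> \<open>This is the variational inequality saying that \<open>q\<close> is the
    projection of \<open>s * p\<close> onto the dual ball.\<close>
  have max: "ip r (\<lambda>t. s * p t - q t) \<le> ip q (\<lambda>t. s * p t - q t)" if "r \<in> dual_ball" for r
    unfolding d ip_cmult_right
    using dual_ball_imp_le_TV[OF that dL2] TVd lam by simp
  have neg: "ip (\<lambda>t. - u t) v = - ip u v" "ip v (\<lambda>t. - u t) = - ip v u" for u v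
    using ip_cmult_left[of "-1" u v] ip_cmult_right[of v "-1" u] by simp_all
  have lower: "s * ip p (indicator {..t}) - (s - 1) \<le> ip q (indicator {..t})" if "t \<in> {0..1}" for t
    using obstacle_comparison[OF p q s max that] .
  \<comment> \<open>The dual ball and the variational inequality are symmetric under a change of
    sign, so the lower bound for \<open>-p\<close> and \<open>-q\<close> is the upper bound
    here.\<close>
  have upper: "ip q (indicator {..t}) \<le> s * ip p (indicator {..t}) + (s - 1)" if t: "t \<in> {0..1}" for t
  proof -
    have "s * ip (\<lambda>t. - p t) (indicator {..t}) - (s - 1) \<le> ip (\<lambda>t. - q t) (indicator {..t})"
    proof (rule obstacle_comparison[OF dual_ball_uminus[OF p] dual_ball_uminus[OF q] s _ t])
      fix r assume "r \<in> dual_ball"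
      from max[OF dual_ball_uminus[OF this]]
      have "ip r (\<lambda>t. - (s * p t - q t)) \<le> ip (\<lambda>t. - q t) (\<lambda>t. - (s * p t - q t))"
        unfolding neg by simp
      then show "ip r (\<lambda>t. s * - p t - - q t) \<le> ip (\<lambda>t. - q t) (\<lambda>t. s * - p t - - q t)"
        by (simp add: algebra_simps)
    qed
    then show ?thesis by (simp add: neg)
  qed
  \<comment> \<open>By the two bounds, moving from \<open>p\<close> slightly away from \<open>q\<close> stays in the dual ball; testing
    with \<open>a\<close>, at which \<open>p\<close> is maximal, then gives \<open>ip p a \<le> ip q a\<close>.\<close>
  define c where "c = 1 / s"
  have c: "0 < c" "c * s = 1" using s by (auto simp: c_def)
  have r_eq: "ip (\<lambda>t. (1 + c) * p t + (- c) * q t) v = (1 + c) * ip p v + (- c) * ip q v" if "v \<in> L2_01" for v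
    by (rule ip_lincomb_left[OF pL2 qL2 that])
  have "(\<lambda>t. (1 + c) * p t + (- c) * q t) \<in> dual_ball"
    unfolding dual_ball_def mem_Collect_eq
  proof (intro conjI ballI L2_01_lincomb[OF pL2 qL2])
    fix t :: real assume t: "t \<in> {0..1}"
    let ?W = "ip p (indicator {..t})" and ?V = "ip q (indicator {..t})"
    have "\<bar>?W\<bar> \<le> 1" using p t by (simp add: dual_ball_def)
    \<comment> \<open>After scaling, \<open>c * ?V\<close> lies within \<open>1 - c\<close> of
      \<open>?W\<close>. Hence \<open>(1 + c) * ?W - c * ?V\<close> lies within \<open>1 - c\<close>
      of \<open>c * ?W\<close>, whose modulus is at most \<open>c\<close>.\<close>
    have "c * (s * ?W - (s - 1)) \<le> c * ?V" "c * ?V \<le> c * (s * ?W + (s - 1))"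
      using lower[OF t] upper[OF t] c by (auto intro: mult_left_mono)
    moreover have "c * (s * ?W - (s - 1)) = ?W - 1 + c" "c * (s * ?W + (s - 1)) = ?W + 1 - c"
      using c by (simp_all add: algebra_simps)
    moreover have "c * ?W \<le> c" "- c \<le> c * ?W"
      using mult_left_mono[of ?W 1 c] mult_left_mono[of "-1" ?W c] c \<open>\<bar>?W\<bar> \<le> 1\<close> by auto
    ultimately have "\<bar>(1 + c) * ?W + (- c) * ?V\<bar> \<le> 1"
      by (simp add: abs_le_iff algebra_simps)
    then show "\<bar>ip (\<lambda>t. (1 + c) * p t + (- c) * q t) (indicator {..t})\<bar> \<le> 1"
      by (simp only: r_eq[OF L2_01_indicator] atMost_borel)
  next
    show "ip (\<lambda>t. (1 + c) * p t + (- c) * q t) (indicator {..1}) = 0"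
      using p q by (subst r_eq) (simp_all add: L2_01_indicator dual_ball_def)
  qed
  from dual_ball_imp_le_TV[OF this aL2] have "c * ip p a \<le> c * ip q a"
    unfolding r_eq[OF aL2] TVa by (simp add: algebra_simps)
  then have pq: "ip p a \<le> ip q a" using c by simp
  \<comment> \<open>Subadditivity along \<open>x = a + (x - a)\<close>, with both variations
    controlled by pairings with the same \<open>q\<close>, bounds \<open>TV x\<close> by
    \<open>ip q x\<close>.\<close>
  have "TV x = TV (\<lambda>t. a t + (x t - a t))" by simp
  also have "\<dots> \<le> TV a + TV (\<lambda>t. x t - a t)"
    by (rule TV_triangle[OF aL2 dL2])
  also have "\<dots> \<le> ereal (ip q a + ip q (\<lambda>t. x t - a t))"
    using pq by (simp add: TVa TVd)
  also have "ip q a + ip q (\<lambda>t. x t - a t) = ip q x"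
    using aL2 xL2 qL2 by (simp add: ip_diff_right)
  finally show ?thesis
    using q unfolding q_def by (intro dual_imp_tik_minimizer y lam xL2)
qed

theorem mainTheorem19:
  fixes y :: "real \<Rightarrow> real" and lam :: "nat \<Rightarrow> real" and x :: "nat \<Rightarrow> real \<Rightarrow> real"
  assumes "y \<in> L2_01"
    and "\<And>k. lam k > 0"
    and "mono lam"
    and "is_tik_minimizer (lam 0) y (x 0)"
    and "\<And>k. k \<ge> 1 \<Longrightarrow> is_mhdm_step (lam k) y (x (k - 1)) (x k)"
  shows "\<forall>k. is_tik_minimizer (lam k) y (x k)"
proof
  fix k
  show "is_tik_minimizer (lam k) y (x k)"
  proof (induction k)
    case 0
    show ?case by (rule assms(4))
  next
    case (Suc k)
    have "is_mhdm_step (lam (Suc k)) y (x k) (x (Suc k))"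
      using assms(5)[of "Suc k"] by simp
    moreover have "lam k \<le> lam (Suc k)"
      using assms(3) by (simp add: monoD)
    ultimately show ?case
      using mhdm_step_tik_minimizer[OF assms(1) assms(2) _ Suc.IH] by blast
  qed
qed

end
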